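(* Let $\Omega\subset\mathbb{R}^2$ be a bounded connected open set. Let $(K_\varepsilon)_{\varepsilon>0}$ be a family of compact connected sets contained in $\Omega$ concentrating to a point $x_0\in\Omega$. Let $\delta_\varepsilon=\operatorname{diam}K_\varepsilon$, so that $\delta_\varepsilon\to0^+$ as $\varepsilon\to0^+$. Then $$\mathrm{Cap}_\Omega(K_\varepsilon)=\frac{2\pi}{|\log\delta_\varepsilon|}+O\left(\frac{1}{\log^2\delta_\varepsilon}\right)\quad\text{as }\varepsilon\to0^+.$$
   Context: For a compact set $K\subset\Omega$, the condenser capacity of $K$ in $\Omega$ is $$\mathrm{Cap}_\Omega(K)=\inf\Big\{\int_\Omega|\nabla f|^2\,dx:\ f\in H^1_0(\Omega),\ f-\eta_K\in H^1_0(\Omega\setminus K)\Big\},$$ where $\eta_K$ is any fixed smooth function with support in $\Omega$ and $\eta_K\equiv1$ in a neighborhood of $K$. A family $\{K_\varepsilon\}_{\varepsilon>0}$ of compact subsets of $\Omega$ is concentrating to a point $x_0\in\Omega$ if for every open $U\subseteq\Omega$ with $x_0\in U$ there exists $\varepsilon_U>0$ such that $K_\varepsilon\subset U$ for every $\varepsilon<\varepsilon_U$. The sets $K_\varepsilon$ are understood to have positive diameter, $\delta_\varepsilon>0$. *)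

theory Defs
  imports "HOL-Analysis.Analysis" "HOL-Library.Landau_Symbols"
begin

text \<open>
  Functions on an open set \<open>U\<close> are represented by total functions on the whole space.  Elements of
  \<open>C\<^sub>c\<^sup>\<infinity>(U)\<close> and \<open>H\<^sup>1\<^sub>0(U)\<close> are represented by their extension by zero, so that
  \<open>H\<^sup>1\<^sub>0(\<Omega> - K)\<close> sits inside \<open>H\<^sup>1\<^sub>0(\<Omega>)\<close>.  For \<open>H\<^sup>1(U)\<close> only the values on \<open>U\<close> matter.
\<close>

primrec cont_diff :: "nat \<Rightarrow> ('a::euclidean_space \<Rightarrow> real) \<Rightarrow> bool" where
  "cont_diff 0 f \<longleftrightarrow> continuous_on UNIV f"
| "cont_diff (Suc k) f \<longleftrightarrow>
     (\<forall>x. f differentiable at x) \<and>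
     (\<forall>i\<in>Basis. cont_diff k (\<lambda>x. frechet_derivative f (at x) i))"

definition smooth :: "('a::euclidean_space \<Rightarrow> real) \<Rightarrow> bool" where
  "smooth f \<longleftrightarrow> (\<forall>k. cont_diff k f)"

definition test_functions :: "'a::euclidean_space set \<Rightarrow> ('a \<Rightarrow> real) set" where
  "test_functions U =
     {\<phi>. smooth \<phi> \<and> compact (closure {x. \<phi> x \<noteq> 0}) \<and> closure {x. \<phi> x \<noteq> 0} \<subseteq> U}"

definition locally_integrable ::
    "'a::euclidean_space set \<Rightarrow> ('a \<Rightarrow> 'b::{banach, second_countable_topology}) \<Rightarrow> bool" where
  "locally_integrable U f \<longleftrightarrow> (\<forall>C. compact C \<and> C \<subseteq> U \<longrightarrow> integrable (lebesgue_on C) f)"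

definition square_integrable ::
    "'a::euclidean_space set \<Rightarrow> ('a \<Rightarrow> 'b::{banach, second_countable_topology}) \<Rightarrow> bool" where
  "square_integrable U f \<longleftrightarrow>
     f \<in> borel_measurable (lebesgue_on U) \<and> integrable (lebesgue_on U) (\<lambda>x. (norm (f x))\<^sup>2)"

definition has_weak_gradient ::
    "'a::euclidean_space set \<Rightarrow> ('a \<Rightarrow> real) \<Rightarrow> ('a \<Rightarrow> 'a) \<Rightarrow> bool" where
  "has_weak_gradient U f g \<longleftrightarrow>
     locally_integrable U f \<and> locally_integrable U g \<and>
     (\<forall>\<phi>\<in>test_functions U. \<forall>i\<in>Basis.
        (LINT x|lebesgue_on U. f x * frechet_derivative \<phi> (at x) i) =
        - (LINT x|lebesgue_on U. (g x \<bullet> i) * \<phi> x))"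

text \<open>The weak gradient is unique up to a null set; all uses below are insensitive to the choice.\<close>

definition weak_gradient :: "'a::euclidean_space set \<Rightarrow> ('a \<Rightarrow> real) \<Rightarrow> 'a \<Rightarrow> 'a" where
  "weak_gradient U f = (SOME g. has_weak_gradient U f g)"

definition H1 :: "'a::euclidean_space set \<Rightarrow> ('a \<Rightarrow> real) set" where
  "H1 U = {f. square_integrable U f \<and>
              (\<exists>g. has_weak_gradient U f g \<and> square_integrable U g)}"

definition H1_norm :: "'a::euclidean_space set \<Rightarrow> ('a \<Rightarrow> real) \<Rightarrow> real" where
  "H1_norm U f = sqrt ((LINT x|lebesgue_on U. (f x)\<^sup>2) +
                       (LINT x|lebesgue_on U. (norm (weak_gradient U f x))\<^sup>2))"

definition H10 :: "'a::euclidean_space set \<Rightarrow> ('a \<Rightarrow> real) set" where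
  "H10 U = {f \<in> H1 U.
     (\<exists>\<phi>::nat \<Rightarrow> 'a \<Rightarrow> real. (\<forall>n. \<phi> n \<in> test_functions U) \<and>
        (\<lambda>n. H1_norm U (\<lambda>x. f x - \<phi> n x)) \<longlonglongrightarrow> 0) \<and>
     (AE x in lebesgue. x \<notin> U \<longrightarrow> f x = 0)}"

definition is_cutoff :: "'a::euclidean_space set \<Rightarrow> 'a set \<Rightarrow> ('a \<Rightarrow> real) \<Rightarrow> bool" where
  "is_cutoff \<Omega> K \<eta> \<longleftrightarrow> \<eta> \<in> test_functions \<Omega> \<and> (\<exists>V. open V \<and> K \<subseteq> V \<and> (\<forall>x\<in>V. \<eta> x = 1))"

text \<open>
  Two cutoffs differ by an element of \<open>C\<^sub>c\<^sup>\<infinity>(\<Omega> - K)\<close>, so the capacity does not depend on which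
  one is fixed.
\<close>

definition cutoff :: "'a::euclidean_space set \<Rightarrow> 'a set \<Rightarrow> 'a \<Rightarrow> real" where
  "cutoff \<Omega> K = (SOME \<eta>. is_cutoff \<Omega> K \<eta>)"

definition capacity :: "'a::euclidean_space set \<Rightarrow> 'a set \<Rightarrow> real" where
  "capacity \<Omega> K =
     Inf {LINT x|lebesgue_on \<Omega>. (norm (weak_gradient \<Omega> f x))\<^sup>2 | f.
            f \<in> H10 \<Omega> \<and> (\<lambda>x. f x - cutoff \<Omega> K x) \<in> H10 (\<Omega> - K)}"

definition concentrating ::
    "'a::topological_space set \<Rightarrow> (real \<Rightarrow> 'a set) \<Rightarrow> 'a \<Rightarrow> bool" where
  "concentrating \<Omega> K x0 \<longleftrightarrow>
     (\<forall>U. open U \<and> U \<subseteq> \<Omega> \<and> x0 \<in> U \<longrightarrow>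
        (\<exists>\<epsilon>U>0. \<forall>\<epsilon>. 0 < \<epsilon> \<and> \<epsilon> < \<epsilon>U \<longrightarrow> K \<epsilon> \<subseteq> U))"

end

theory Submission
  imports Defs
begin

text \<open>
  Upper bound: \<open>K\<close> lies in a disc of radius \<open>\<delta>\<close> about one of its points, so its capacity is at most
  the energy of a smooth truncation of \<open>ln (R / r) / ln (R / \<delta>)\<close>.

  Lower bound: take two points \<open>p, q\<close> of \<open>K\<close> at distance \<open>\<delta>\<close>.  Being connected, \<open>K\<close> meets every
  circle about \<open>p\<close> of radius at most \<open>\<delta>\<close>.  A function that is 1 on \<open>K\<close> therefore cannot be far from 1 on
  average over the annulus \<open>\<delta> / 2 \<le> r \<le> \<delta>\<close> unless its energy there is large, and bringing it
  down to 0 at a fixed radius \<open>M\<close> costs the energy of the logarithmic potential.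
  No symmetrisation or conformal mapping is needed, since an error \<open>O(1)\<close> in the
  reciprocal of the capacity is allowed.
\<close>

section \<open>Smooth functions\<close>

text \<open>The capacity minimises over Sobolev functions, whose values on null sets such as circles
  carry no information, so the connectedness argument does not apply to them directly. Both bounds
  are therefore reduced to smooth functions equal to 1 near \<open>K\<close>. Such functions are
  admissible, which gives the upper bound; conversely their energies come arbitrarily close to, or
  below, that of any admissible function, which gives the lower bound. The weak gradient is picked
  by choice, so this reduction rests on its uniqueness almost everywhere, hence on the fundamental
  lemma of the calculus of variations. With \<open>L = - ln (\<delta> \<epsilon>)\<close> the two
  bounds are \<open>2 * pi / (L + c1)\<close> and \<open>2 * pi / (L + c2)\<close>, where
  \<open>c1\<close> and \<open>c2\<close> do not depend on \<open>\<epsilon>\<close>. Since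
  \<open>1 / (L + c) - 1 / L\<close> is of order \<open>1 / L^2\<close> for bounded
  \<open>c\<close>, wasteful constants such as \<open>272\<close> and \<open>18 * pi\<close> are
  harmless; only the coefficient of \<open>L\<close> has to be sharp.\<close>

lemma cont_diff_SucD: "cont_diff (Suc k) f \<Longrightarrow> cont_diff k f"
proof (induction k arbitrary: f)
  case 0
  then show ?case
    by (auto intro!: continuous_at_imp_continuous_on differentiable_imp_continuous_within)
next
  case (Suc k)
  then show ?case by (auto simp del: cont_diff.simps(1)) 
qed

lemma cont_diff_continuous: "cont_diff k f \<Longrightarrow> continuous_on UNIV f"
  by (induction k) (use cont_diff_SucD in auto)

lemma cont_diff_const [intro]: "cont_diff k (\<lambda>_. c)"
  by (induction k arbitrary: c) (auto intro: cont_diff_SucD)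

text \<open>\<open>frechet_derivative\<close> is defined by choice. This rule and the elimination
  rule after it replace it by any known derivative \<open>f'\<close>, so that the product and chain
  rules can drive the inductions on \<open>k\<close>.\<close>

lemma cont_diff_SucI:
  assumes "\<And>x. (f has_derivative f' x) (at x)"
    and "\<And>i. i \<in> Basis \<Longrightarrow> cont_diff k (\<lambda>x. f' x i)"
  shows "cont_diff (Suc k) f"
proof -
  have "frechet_derivative f (at x) = f' x" for x
    using frechet_derivative_at[OF assms(1)] by simp
  then show ?thesis
    using assms by (auto simp: differentiable_def)
qed

lemma cont_diff_SucE:
  assumes "cont_diff (Suc k) f"
  obtains f' where "\<And>x. (f has_derivative f' x) (at x)"
    and "\<And>i. i \<in> Basis \<Longrightarrow> cont_diff k (\<lambda>x. f' x i)"
  using assms that[of "\<lambda>x. frechet_derivative f (at x)"]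
  by (simp add: frechet_derivative_works)

lemma cont_diff_add:
  "cont_diff k f \<Longrightarrow> cont_diff k g \<Longrightarrow> cont_diff k (\<lambda>x. f x + g x)"
proof (induction k arbitrary: f g)
  case 0
  then show ?case by (auto intro: continuous_intros)
next
  case (Suc k)
  obtain f' where f': "\<And>x. (f has_derivative f' x) (at x)" "\<And>i. i \<in> Basis \<Longrightarrow> cont_diff k (\<lambda>x. f' x i)"
    using cont_diff_SucE[OF Suc.prems(1)] by blast
  obtain g' where g': "\<And>x. (g has_derivative g' x) (at x)" "\<And>i. i \<in> Basis \<Longrightarrow> cont_diff k (\<lambda>x. g' x i)"
    using cont_diff_SucE[OF Suc.prems(2)] by blast
  show ?case
    by (rule cont_diff_SucI[OF has_derivative_add[OF f'(1) g'(1)]]) (simp add: Suc.IH f' g')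
qed

lemma cont_diff_mult:
  "cont_diff k f \<Longrightarrow> cont_diff k g \<Longrightarrow> cont_diff k (\<lambda>x. f x * g x)"
proof (induction k arbitrary: f g)
  case 0
  then show ?case by (auto intro: continuous_intros)
next
  case (Suc k)
  obtain f' where f': "\<And>x. (f has_derivative f' x) (at x)" "\<And>i. i \<in> Basis \<Longrightarrow> cont_diff k (\<lambda>x. f' x i)"
    using cont_diff_SucE[OF Suc.prems(1)] by blast
  obtain g' where g': "\<And>x. (g has_derivative g' x) (at x)" "\<And>i. i \<in> Basis \<Longrightarrow> cont_diff k (\<lambda>x. g' x i)"
    using cont_diff_SucE[OF Suc.prems(2)] by blast
  show ?case
    by (rule cont_diff_SucI[OF has_derivative_mult[OF f'(1) g'(1)]])
      (auto intro!: cont_diff_add Suc.IH f' g' cont_diff_SucD[OF Suc.prems(1)] cont_diff_SucD[OF Suc.prems(2)])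
qed

lemma cont_diff_compose:
  fixes h :: "real \<Rightarrow> real"
  shows "cont_diff k h \<Longrightarrow> cont_diff k u \<Longrightarrow> cont_diff k (\<lambda>x. h (u x))"
proof (induction k arbitrary: h u)
  case 0
  then show ?case by (auto intro: continuous_on_compose2)
next
  case (Suc k)
  obtain h' where h': "\<And>x. (h has_derivative h' x) (at x)" "cont_diff k (\<lambda>x. h' x 1)"
    using cont_diff_SucE[OF Suc.prems(1)] by (metis Basis_real_def insertI1)
  obtain u' where u': "\<And>x. (u has_derivative u' x) (at x)" "\<And>i. i \<in> Basis \<Longrightarrow> cont_diff k (\<lambda>x. u' x i)"
    using cont_diff_SucE[OF Suc.prems(2)] by blast
  \<comment> \<open>A linear map on the reals is multiplication by its value at 1. This turns the
    chain rule into a product of functions of order \<open>k\<close>, which the induction can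
    handle.\<close>
  have h'_lin: "h' x y = h' x 1 * y" for x y
    using linear_scale[OF has_derivative_linear[OF h'(1)], of x y 1] by simp
  show ?case
  proof (rule cont_diff_SucI[OF has_derivative_compose[OF u'(1) h'(1)]])
    fix i :: 'a assume "i \<in> Basis"
    then have "cont_diff k (\<lambda>x. h' (u x) 1 * u' x i)"
      by (intro cont_diff_mult Suc.IH[OF h'(2)] u' cont_diff_SucD[OF Suc.prems(2)])
    then show "cont_diff k (\<lambda>x. h' (u x) (u' x i))"
      by (subst h'_lin)
  qed
qed

lemma cont_diff_inverse:
  "cont_diff k f \<Longrightarrow> (\<And>x. f x \<noteq> 0) \<Longrightarrow> cont_diff k (\<lambda>x. inverse (f x))"
proof (induction k arbitrary: f)
  case 0
  then show ?case by (auto intro: continuous_intros)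
next
  case (Suc k)
  obtain f' where f': "\<And>x. (f has_derivative f' x) (at x)" "\<And>i. i \<in> Basis \<Longrightarrow> cont_diff k (\<lambda>x. f' x i)"
    using cont_diff_SucE[OF Suc.prems(1)] by blast
  show ?case
  proof (rule cont_diff_SucI)
    show "((\<lambda>x. inverse (f x)) has_derivative (\<lambda>y. - 1 * (inverse (f x) * f' x y * inverse (f x)))) (at x)" for x
      using Deriv.has_derivative_inverse[OF Suc.prems(2) f'(1)] by simp
    show "cont_diff k (\<lambda>x. - 1 * (inverse (f x) * f' x i * inverse (f x)))" if "i \<in> Basis" for i
      by (intro cont_diff_mult cont_diff_const f' that Suc.IH cont_diff_SucD[OF Suc.prems(1)] Suc.prems(2))
  qed
qed

lemma cont_diff_inner: "cont_diff k (\<lambda>x. x \<bullet> a)"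
proof (cases k)
  case (Suc m)
  show ?thesis unfolding Suc
    by (rule cont_diff_SucI[where f' = "\<lambda>_ y. y \<bullet> a"])
      (auto intro!: derivative_eq_intros cont_diff_const)
qed (auto intro: continuous_intros)

lemma smooth_const: "smooth (\<lambda>_. c)"
  and smooth_inner: "smooth (\<lambda>x. x \<bullet> a)"
  and smooth_add: "smooth f \<Longrightarrow> smooth g \<Longrightarrow> smooth (\<lambda>x. f x + g x)"
  and smooth_mult: "smooth f \<Longrightarrow> smooth g \<Longrightarrow> smooth (\<lambda>x. f x * g x)"
  and smooth_inverse: "smooth f \<Longrightarrow> (\<And>x. f x \<noteq> 0) \<Longrightarrow> smooth (\<lambda>x. inverse (f x))"
  and smooth_compose: "smooth h \<Longrightarrow> smooth f \<Longrightarrow> smooth (\<lambda>x. h (f x))"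
  unfolding smooth_def
  by (simp_all add: cont_diff_const cont_diff_inner cont_diff_add cont_diff_mult cont_diff_inverse cont_diff_compose)

lemma smooth_ident: "smooth (\<lambda>x::real. x)"
  using smooth_inner[of "1::real"] by simp

lemma smooth_diff: "smooth f \<Longrightarrow> smooth g \<Longrightarrow> smooth (\<lambda>x. f x - g x)"
  using smooth_add[OF _ smooth_mult[OF smooth_const[of "-1"]], of f g] by simp

lemma smooth_sum: "(\<And>i. i \<in> I \<Longrightarrow> smooth (f i)) \<Longrightarrow> smooth (\<lambda>x. \<Sum>i\<in>I. f i x)"
  by (induction I rule: infinite_finite_induct) (auto intro: smooth_const smooth_add)

lemma smooth_prod: "(\<And>i. i \<in> I \<Longrightarrow> smooth (f i)) \<Longrightarrow> smooth (\<lambda>x. \<Prod>i\<in>I. f i x)"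
  by (induction I rule: infinite_finite_induct) (auto intro: smooth_const smooth_mult)

lemma smooth_continuous: "smooth f \<Longrightarrow> continuous_on S f"
  using cont_diff_continuous[of 0 f] continuous_on_subset unfolding smooth_def by blast

lemma smooth_has_derivative: "smooth f \<Longrightarrow> (f has_derivative frechet_derivative f (at x)) (at x)"
  using cont_diff.simps(2)[of 0 f] unfolding smooth_def by (metis frechet_derivative_works)

lemma smooth_partial: "smooth f \<Longrightarrow> i \<in> Basis \<Longrightarrow> smooth (\<lambda>x. frechet_derivative f (at x) i)"
  unfolding smooth_def using cont_diff.simps(2)[of _ f] by blast

lemma smooth_antiderivative:
  fixes h w :: "real \<Rightarrow> real"
  assumes "\<And>x. (h has_real_derivative w x) (at x)" "smooth w"
  shows "smooth h"
  unfolding smooth_def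
proof
  fix k
  have "cont_diff (Suc k) h"
    by (rule cont_diff_SucI[OF assms(1)[unfolded has_field_derivative_def]])
      (use assms(2) in \<open>simp add: smooth_def\<close>)
  then show "cont_diff k h" by (rule cont_diff_SucD)
qed

text \<open>For \<open>m = 0\<close> this is the classical flat function
  \<open>exp (- 1 / t)\<close>. The powers of \<open>1 / t\<close> are included because they make
  the family closed under differentiation up to linear combinations, so one induction proves all
  members smooth.\<close>

definition flat_step :: "nat \<Rightarrow> real \<Rightarrow> real" where
  "flat_step m t = (if t \<le> 0 then 0 else inverse t ^ m * exp (- inverse t))"

lemma flat_step_tendsto_0: "(flat_step m \<longlongrightarrow> 0) (at 0)"
proof -
  have "((\<lambda>u. u ^ m / exp u) \<longlongrightarrow> (0::real)) at_top"
    by (rule tendsto_power_div_exp_0)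
  then have "((\<lambda>t. inverse t ^ m / exp (inverse t)) \<longlongrightarrow> (0::real)) (at_right 0)"
    using filterlim_compose filterlim_inverse_at_top_right by blast
  then have "(flat_step m \<longlongrightarrow> 0) (at_right 0)"
    by (rule Lim_transform_eventually)
      (auto simp: flat_step_def eventually_at_right_less exp_minus field_simps intro!: eventually_at_rightI[of 0 1])
  moreover have "(flat_step m \<longlongrightarrow> 0) (at_left 0)"
    by (rule tendsto_eventually) (auto simp: flat_step_def intro!: eventually_at_leftI[of "-1" 0])
  ultimately show ?thesis
    by (simp add: filterlim_at_split)
qed

lemma flat_step_derivative:
  "(flat_step m has_real_derivative (flat_step (m + 2) t - m * flat_step (m + 1) t)) (at t)"
proof -
  consider "t < 0" | "t = 0" | "t > 0" by linarith
  then show ?thesis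
  proof cases
    case 1
    have "((\<lambda>_. 0) has_real_derivative (flat_step (m + 2) t - m * flat_step (m + 1) t)) (at t)"
      using 1 by (simp add: flat_step_def)
    then show ?thesis
      by (rule DERIV_cong_ev[THEN iffD2, rotated -1])
        (use 1 in \<open>auto simp: flat_step_def eventually_nhds intro!: exI[of _ "{..<0}"]\<close>)
  next
    case 2
    \<comment> \<open>At 0 the difference quotient of member \<open>m\<close> is exactly member
      \<open>m + 1\<close>, whose limit is already known to be 0.\<close>
    have "((\<lambda>h. (flat_step m h - flat_step m 0) / h) \<longlongrightarrow> 0) (at 0)"
    proof (rule Lim_transform_eventually[OF flat_step_tendsto_0[of "m + 1"]])
      show "\<forall>\<^sub>F h in at 0. flat_step (m + 1) h = (flat_step m h - flat_step m 0) / h"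
        by (auto simp: flat_step_def field_simps intro!: always_eventually)
    qed
    then show ?thesis
      unfolding 2 has_field_derivative_def has_field_derivative_iff[symmetric]
      by (simp add: has_field_derivative_def[symmetric] DERIV_def flat_step_def)
  next
    case 3
    define v where "v = inverse t"
    have "(inverse has_real_derivative - (v ^ 2)) (at t)"
      using 3 DERIV_inverse[of t UNIV] by (simp add: v_def numeral_2_eq_2)
    with 3 have "((\<lambda>t. inverse t ^ m * exp (- inverse t)) has_real_derivative
        (real m * v ^ (m - 1) * - (v ^ 2)) * exp (- v) + v ^ m * (exp (- v) * v ^ 2)) (at t)"
      by (auto intro!: derivative_eq_intros simp: v_def power2_eq_square algebra_simps)
    moreover have "(real m * v ^ (m - 1) * - (v ^ 2)) * exp (- v) + v ^ m * (exp (- v) * v ^ 2) =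
        flat_step (m + 2) t - m * flat_step (m + 1) t"
    proof -
      \<comment> \<open>Here \<open>m - 1\<close> is truncated subtraction; for \<open>m = 0\<close>
        both sides vanish through the factor \<open>real m\<close>.\<close>
      have *: "real m * v ^ (m - 1) * v ^ 2 = m * v ^ (m + 1)"
        by (cases m) (simp_all add: power2_eq_square)
      have "(real m * v ^ (m - 1) * - (v ^ 2)) * exp (- v) + v ^ m * (exp (- v) * v ^ 2) =
          v ^ (m + 2) * exp (- v) - (real m * v ^ (m - 1) * v ^ 2) * exp (- v)"
        by (simp add: power_add power2_eq_square algebra_simps)
      also have "\<dots> = flat_step (m + 2) t - m * flat_step (m + 1) t"
        unfolding * using 3 by (simp add: flat_step_def v_def)
      finally show ?thesis .
    qed
    ultimately have "((\<lambda>t. inverse t ^ m * exp (- inverse t)) has_real_derivative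
        (flat_step (m + 2) t - m * flat_step (m + 1) t)) (at t)"
      by simp
    then show ?thesis
      by (rule DERIV_cong_ev[THEN iffD2, rotated -1])
        (use 3 in \<open>auto simp: flat_step_def eventually_nhds intro!: exI[of _ "{0<..}"]\<close>)
  qed
qed

lemma smooth_flat_step: "smooth (flat_step m)"
  unfolding smooth_def
proof
  fix k show "cont_diff k (flat_step m)"
  proof (induction k arbitrary: m)
    case 0
    show ?case
      using DERIV_isCont[OF flat_step_derivative] by (simp add: continuous_at_imp_continuous_on)
  next
    case (Suc k)
    show ?case
    proof (rule cont_diff_SucI[OF flat_step_derivative[unfolded has_field_derivative_def]])
      fix i :: real
      have "cont_diff k (\<lambda>x. (flat_step (m + 2) x + (- real m) * flat_step (m + 1) x) * i)"
        by (intro cont_diff_add cont_diff_mult cont_diff_const Suc)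
      then show "cont_diff k (\<lambda>x. (flat_step (m + 2) x - real m * flat_step (m + 1) x) * i)"
        by simp
    qed
  qed
qed

section \<open>Test functions\<close>

lemma test_functionsD:
  assumes "\<phi> \<in> test_functions U"
  shows "smooth \<phi>" "compact (closure {x. \<phi> x \<noteq> 0})" "closure {x. \<phi> x \<noteq> 0} \<subseteq> U"
    "x \<notin> U \<Longrightarrow> \<phi> x = 0"
  using assms closure_subset[of "{x. \<phi> x \<noteq> 0}"] unfolding test_functions_def by auto

text \<open>Any compact set outside which the function vanishes will do: being closed, it contains
  the support. Supports then never have to be computed.\<close>

lemma test_functionsI:
  assumes "smooth \<phi>" "compact C" "C \<subseteq> U" "\<And>x. x \<notin> C \<Longrightarrow> \<phi> x = 0"
  shows "\<phi> \<in> test_functions U"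
proof -
  have "closure {x. \<phi> x \<noteq> 0} \<subseteq> C"
    using assms(2,4) by (intro closure_minimal compact_imp_closed) auto
  moreover from this have "compact (closure {x. \<phi> x \<noteq> 0})"
    using compact_Int_closed[OF assms(2) closed_closure, of "{x. \<phi> x \<noteq> 0}"] by (simp add: Int_absorb1)
  ultimately show ?thesis
    unfolding test_functions_def using assms(1,3) by auto
qed

lemma test_functionsE:
  assumes "\<phi> \<in> test_functions U"
  obtains C where "compact C" "C \<subseteq> U" "\<And>x. x \<notin> C \<Longrightarrow> \<phi> x = 0"
  using test_functionsD[OF assms] closure_subset[of "{x. \<phi> x \<noteq> 0}"] that by blast

lemma test_functions_mono: "\<phi> \<in> test_functions U \<Longrightarrow> U \<subseteq> V \<Longrightarrow> \<phi> \<in> test_functions V"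
  unfolding test_functions_def by auto

lemma test_functions_add:
  assumes "\<phi> \<in> test_functions U" "\<psi> \<in> test_functions U"
  shows "(\<lambda>x. \<phi> x + \<psi> x) \<in> test_functions U"
proof -
  obtain C where "compact C" "C \<subseteq> U" "\<And>x. x \<notin> C \<Longrightarrow> \<phi> x = 0"
    by (rule test_functionsE[OF assms(1)]) blast
  moreover obtain D where "compact D" "D \<subseteq> U" "\<And>x. x \<notin> D \<Longrightarrow> \<psi> x = 0"
    by (rule test_functionsE[OF assms(2)]) blast
  ultimately show ?thesis
    using smooth_add[OF assms[THEN test_functionsD(1)]]
    by (intro test_functionsI[of _ "C \<union> D"]) auto
qed

lemma test_functions_mult_smooth:
  assumes "smooth f" "\<phi> \<in> test_functions U"
  shows "(\<lambda>x. f x * \<phi> x) \<in> test_functions U"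
proof -
  obtain C where "compact C" "C \<subseteq> U" "\<And>x. x \<notin> C \<Longrightarrow> \<phi> x = 0"
    by (rule test_functionsE[OF assms(2)]) blast
  then show ?thesis
    using smooth_mult[OF assms(1) test_functionsD(1)[OF assms(2)]]
    by (intro test_functionsI[of _ C]) auto
qed

lemma frechet_derivative_const_open:
  assumes "open V" "x \<in> V" "\<And>y. y \<in> V \<Longrightarrow> f y = c"
  shows "frechet_derivative f (at x) = (\<lambda>_. 0)"
proof -
  have "(f has_derivative (\<lambda>_. 0)) (at x)"
    by (rule has_derivative_transform_within_open[OF has_derivative_const assms(1,2)])
      (use assms(3) in auto)
  then show ?thesis
    using frechet_derivative_at by metis
qed

lemma test_functions_partial:
  assumes "\<phi> \<in> test_functions U" "i \<in> Basis"
  shows "(\<lambda>x. frechet_derivative \<phi> (at x) i) \<in> test_functions U"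
proof -
  obtain C where C: "compact C" "C \<subseteq> U" "\<And>x. x \<notin> C \<Longrightarrow> \<phi> x = 0"
    by (rule test_functionsE[OF assms(1)]) blast
  have "frechet_derivative \<phi> (at x) = (\<lambda>_. 0)" if "x \<notin> C" for x
    by (rule frechet_derivative_const_open[of "- C" _ _ 0])
      (use that C in \<open>auto simp: open_Compl compact_imp_closed\<close>)
  with C show ?thesis
    using smooth_partial[OF test_functionsD(1)[OF assms(1)] assms(2)]
    by (intro test_functionsI[of _ C]) auto
qed

section \<open>Integrability of compactly supported functions\<close>

lemma continuous_compact_support_integrable:
  fixes h :: "'a::euclidean_space \<Rightarrow> 'b::{banach, second_countable_topology}"
  assumes "continuous_on UNIV h" "compact C" "\<And>x. x \<notin> C \<Longrightarrow> h x = 0"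
  shows "integrable lborel h" "integrable lebesgue h"
proof -
  have "(\<lambda>x. indicator C x *\<^sub>R h x) = h"
    using assms(3) by (auto simp: indicator_def fun_eq_iff)
  then show "integrable lborel h"
    using borel_integrable_compact[OF assms(2) continuous_on_subset[OF assms(1)]] by simp
  then show "integrable lebesgue h"
    using assms(1) by (subst integrable_completion) (auto intro: borel_measurable_continuous_onI)
qed

lemma continuous_compact_support_bounded:
  fixes h :: "'a::topological_space \<Rightarrow> 'b::real_normed_vector"
  assumes "continuous_on UNIV h" "compact C" "\<And>x. x \<notin> C \<Longrightarrow> h x = 0"
  obtains B where "B > 0" "\<And>x. norm (h x) \<le> B"
proof -
  have "bounded (h ` C)"
    using assms by (intro compact_imp_bounded compact_continuous_image) (auto intro: continuous_on_subset)
  then obtain B where "B > 0" "\<And>x. x \<in> C \<Longrightarrow> norm (h x) \<le> B"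
    unfolding bounded_pos by auto
  then show ?thesis
    using that[of B] assms(3) by (metis less_imp_le norm_zero)
qed

lemma continuous_borel_measurable_lebesgue:
  fixes f :: "'a::euclidean_space \<Rightarrow> 'b::{second_countable_topology, real_normed_vector}"
  assumes "continuous_on UNIV f"
  shows "f \<in> borel_measurable lebesgue"
  using assms by (intro measurable_completion) (auto intro: borel_measurable_continuous_onI)

text \<open>The definitions integrate over an open set, while translation and polar coordinates act
  on the whole plane. Extension by zero allows passing between the two.\<close>

lemma lebesgue_on_zero_outside:
  fixes h :: "'a::euclidean_space \<Rightarrow> 'b::{banach, second_countable_topology}"
  assumes "open U" "\<And>x. x \<notin> U \<Longrightarrow> h x = 0"
  shows "integral\<^sup>L (lebesgue_on U) h = integral\<^sup>L lebesgue h"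
    "integrable (lebesgue_on U) h \<longleftrightarrow> integrable lebesgue h"
proof -
  have "(\<lambda>x. indicator U x *\<^sub>R h x) = h"
    using assms(2) by (auto simp: indicator_def fun_eq_iff)
  then show "integral\<^sup>L (lebesgue_on U) h = integral\<^sup>L lebesgue h"
    "integrable (lebesgue_on U) h \<longleftrightarrow> integrable lebesgue h"
    using assms(1) by (simp_all add: integral_restrict_space integrable_restrict_space)
qed

lemma locally_integrable_mult:
  fixes f \<psi> :: "'a::euclidean_space \<Rightarrow> real"
  assumes "locally_integrable U f" "continuous_on UNIV \<psi>"
    and C: "compact C" "C \<subseteq> U" "\<And>x. x \<notin> C \<Longrightarrow> \<psi> x = 0"
  shows "integrable lebesgue (\<lambda>x. f x * \<psi> x)"
proof -
  obtain B where B: "\<And>x. norm (\<psi> x) \<le> B"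
    by (metis assms(2) C(1,3) continuous_compact_support_bounded)
  have "integrable lebesgue (\<lambda>x. indicator C x *\<^sub>R f x)"
    using assms(1) C unfolding locally_integrable_def
    by (subst integrable_restrict_space[symmetric]) (auto simp: compact_imp_closed)
  then have "integrable lebesgue (\<lambda>x. \<psi> x * (indicator C x *\<^sub>R f x))"
  proof (rule Bochner_Integration.integrable_bound[OF integrable_mult_right[of B]])
    show "(\<lambda>x. \<psi> x * (indicator C x *\<^sub>R f x)) \<in> borel_measurable lebesgue"
      by (rule borel_measurable_times[OF continuous_borel_measurable_lebesgue[OF assms(2)]
            borel_measurable_integrable[OF \<open>integrable lebesgue (\<lambda>x. indicator C x *\<^sub>R f x)\<close>]])
    have "\<bar>\<psi> x\<bar> * \<bar>f x\<bar> \<le> \<bar>B\<bar> * \<bar>f x\<bar>" for x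
      using B[of x] by (intro mult_right_mono) auto
    then show "AE x in lebesgue. norm (\<psi> x * (indicator C x *\<^sub>R f x)) \<le> norm (B * (indicator C x *\<^sub>R f x))"
      by (auto simp: abs_mult indicator_def)
  qed
  moreover have "(\<lambda>x. \<psi> x * (indicator C x *\<^sub>R f x)) = (\<lambda>x. f x * \<psi> x)"
    using C(3) by (auto simp: indicator_def fun_eq_iff)
  ultimately show ?thesis by simp
qed

lemma locally_integrable_subset: "locally_integrable U f \<Longrightarrow> V \<subseteq> U \<Longrightarrow> locally_integrable V f"
  unfolding locally_integrable_def by auto

lemma locally_integrable_diff:
  "locally_integrable U f \<Longrightarrow> locally_integrable U g \<Longrightarrow> locally_integrable U (\<lambda>x. f x - g x)"
  unfolding locally_integrable_def by auto

lemma locally_integrable_inner: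
  "locally_integrable U f \<Longrightarrow> locally_integrable U (\<lambda>x. f x \<bullet> i)"
  unfolding locally_integrable_def by auto

lemma continuous_locally_integrable:
  fixes f :: "'a::euclidean_space \<Rightarrow> 'b::{banach, second_countable_topology}"
  assumes "continuous_on UNIV f"
  shows "locally_integrable U f"
  unfolding locally_integrable_def
proof (intro allI impI, elim conjE)
  fix C :: "'a set" assume "compact C" "C \<subseteq> U"
  moreover from this have "integrable lborel (\<lambda>x. indicator C x *\<^sub>R f x)"
    using assms by (intro borel_integrable_compact) (auto intro: continuous_on_subset)
  ultimately show "integrable (lebesgue_on C) f"
    by (subst integrable_restrict_space) (auto intro!: integrable_completion[THEN iffD2] simp: compact_imp_closed)
qed

section \<open>The fundamental lemma of the calculus of variations\<close>

text \<open>The functions below increase to the indicator of \<open>box a b\<close> as \<open>n\<close> grows.\<close>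

definition box_bump :: "'a::euclidean_space \<Rightarrow> 'a \<Rightarrow> nat \<Rightarrow> 'a \<Rightarrow> real" where
  "box_bump a b n x = (\<Prod>i\<in>Basis. flat_step 0 (real (Suc n) * (x \<bullet> i - a \<bullet> i)) * flat_step 0 (real (Suc n) * (b \<bullet> i - x \<bullet> i)))"

lemma flat_step_0_bounds: "0 \<le> flat_step 0 t" "flat_step 0 t \<le> 1"
  by (auto simp: flat_step_def)

lemma box_bump_bounds: "0 \<le> box_bump a b n x" "box_bump a b n x \<le> 1"
  unfolding box_bump_def
  by (auto intro!: prod_nonneg prod_le_1 mult_le_one mult_nonneg_nonneg flat_step_0_bounds)

lemma box_bump_outside: "x \<notin> box a b \<Longrightarrow> box_bump a b n x = 0"
  unfolding box_bump_def by (auto simp: mem_box flat_step_def not_less mult_le_0_iff intro!: bexI)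

lemma smooth_box_bump: "smooth (box_bump a b n)"
  unfolding box_bump_def
  by (intro smooth_prod smooth_mult smooth_compose[OF smooth_flat_step] smooth_const smooth_diff smooth_inner)

lemma flat_step_0_scaled_tendsto:
  assumes "t > 0"
  shows "(\<lambda>n. flat_step 0 (real (Suc n) * t)) \<longlonglongrightarrow> 1"
proof -
  have "(\<lambda>n. exp (- (inverse (real (Suc n)) * inverse t))) \<longlonglongrightarrow> exp (- (0 * inverse t))"
    by (intro tendsto_intros LIMSEQ_inverse_real_of_nat)
  then show ?thesis
    using assms by (simp add: flat_step_def not_le mult_le_0_iff)
qed

lemma box_bump_tendsto: "(\<lambda>n. box_bump a b n x) \<longlonglongrightarrow> indicator (box a b) x"
proof (cases "x \<in> box a b")
  case True
  then have "(\<lambda>n. box_bump a b n x) \<longlonglongrightarrow> (\<Prod>i\<in>(Basis::'a set). 1 * 1)"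
    unfolding box_bump_def
    by (intro tendsto_prod tendsto_mult flat_step_0_scaled_tendsto) (auto simp: mem_box)
  then show ?thesis using True by simp
next
  case False
  then show ?thesis by (simp add: box_bump_outside)
qed

text \<open>Open boxes form an intersection-stable generator of the Borel sets, so a Dynkin-system
  induction extends the vanishing from boxes to all Borel sets; the complement step is where the
  total integral must be 0. A function whose integral over every Borel set vanishes is null.\<close>

lemma integral_boxes_zero_imp_AE_zero:
  fixes h :: "'a::euclidean_space \<Rightarrow> real"
  assumes int: "integrable lebesgue h" and tot: "integral\<^sup>L lebesgue h = 0"
    and boxes: "\<And>a b. (LINT x:box a b|lebesgue. h x) = 0"
  shows "AE x in lebesgue. h x = 0"
proof -
  have si: "set_integrable lebesgue A h" if "A \<in> sets lebesgue" for A
    unfolding set_integrable_def by (rule integrable_mult_indicator[OF that int])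
  have borel: "(LINT x:A|lebesgue. h x) = 0" if "A \<in> sets borel" for A
  proof -
    let ?E = "range (\<lambda>(a, b). box a b::'a set)"
    have sets: "sigma_sets UNIV ?E = sets borel"
      by (simp add: borel_eq_box)
    have "Int_stable ?E"
      by (auto simp: Int_stable_def box_Int_box)
    moreover have "?E \<subseteq> Pow UNIV" by simp
    moreover have "A \<in> sigma_sets UNIV ?E"
      using that sets by simp
    ultimately show ?thesis
    proof (induction rule: sigma_sets_induct_disjoint)
      case (basic A)
      then show ?case using boxes by auto
    next
      case empty
      show ?case by (simp add: set_lebesgue_integral_def)
    next
      case (compl A)
      then have "A \<in> sets lebesgue" using sets by auto
      then have "(LINT x:A \<union> (UNIV - A)|lebesgue. h x) = (LINT x:A|lebesgue. h x) + (LINT x:UNIV - A|lebesgue. h x)"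
        by (intro set_integral_Un si) auto
      then show ?case
        using compl tot by (simp add: set_lebesgue_integral_def)
    next
      case (union A)
      have "range A \<subseteq> sets borel" using union(2) unfolding sets .
      then have "A i \<in> sets lebesgue" for i
        by (metis range_subsetD sets_completionI_sets sets_lborel)
      then have "(LINT x:(\<Union>i. A i)|lebesgue. h x) = (\<Sum>i. (LINT x:(A i)|lebesgue. h x))"
        using union(1) by (intro lebesgue_integral_countable_add si) (auto simp: disjoint_family_on_def)
      then show ?case using union by simp
    qed
  qed
  \<comment> \<open>The last step works in the Borel measure \<open>lborel\<close>, so the Lebesgue
    measurable \<open>h\<close> is replaced by a Borel function equal to it almost
    everywhere.\<close>
  obtain h' where h': "h' \<in> borel_measurable lborel" "AE x in lborel. h x = h' x"
    using completion_ex_borel_measurable_real[OF borel_measurable_integrable[OF int]] by blast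
  have AE: "AE x in lebesgue. h x = h' x"
    by (rule AE_completion[OF h'(2)])
  have h'_leb: "h' \<in> borel_measurable lebesgue"
    using h'(1) by (rule measurable_completion)
  have "integrable lebesgue h'"
    using integrable_cong_AE[OF borel_measurable_integrable[OF int] h'_leb AE] int by simp
  then have int': "integrable lborel h'"
    using h'(1) by (simp add: integrable_completion)
  have "AE x in lborel. h' x = 0"
  proof (rule sigma_finite_measure.density_zero[OF sigma_finite_lborel int'])
    fix A :: "'a set" assume A: "A \<in> sets lborel"
    have "(LINT x:A|lborel. h' x) = (LINT x:A|lebesgue. h' x)"
      unfolding set_lebesgue_integral_def using A
      by (intro integral_completion[symmetric] borel_measurable_scaleR borel_measurable_indicator h'(1))
    also have "\<dots> = (LINT x:A|lebesgue. h x)"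
      unfolding set_lebesgue_integral_def
    proof (rule integral_cong_AE)
      show "(\<lambda>x. indicator A x *\<^sub>R h' x) \<in> borel_measurable lebesgue"
        "(\<lambda>x. indicator A x *\<^sub>R h x) \<in> borel_measurable lebesgue"
        using A by (intro borel_measurable_scaleR borel_measurable_indicator h'_leb
            borel_measurable_integrable[OF int]; simp)+
      show "AE x in lebesgue. indicator A x *\<^sub>R h' x = indicator A x *\<^sub>R h x"
        using AE by eventually_elim simp
    qed
    finally show "(LINT x:A|lborel. h' x) = 0"
      using borel A by simp
  qed
  from AE_completion[OF this] AE show ?thesis
    by eventually_elim simp
qed

text \<open>Testing with \<open>box_bump\<close> and dominated convergence give integral 0 over each
  open box whose closed box lies in \<open>U\<close>. Truncating \<open>g\<close> to one such box
  makes the previous lemma applicable there, and countably many closed boxes cover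
  \<open>U\<close>.\<close>

lemma fundamental_lemma_calculus_of_variations:
  fixes g :: "'a::euclidean_space \<Rightarrow> real"
  assumes "open U" and g: "locally_integrable U g"
    and zero: "\<And>\<phi>. \<phi> \<in> test_functions U \<Longrightarrow> (LINT x|lebesgue. g x * \<phi> x) = 0"
  shows "AE x in lebesgue. x \<in> U \<longrightarrow> g x = 0"
proof -
  have box0: "(LINT x:box a b|lebesgue. g x) = 0" if "cbox a b \<subseteq> U" for a b
  proof -
    have test: "box_bump a b n \<in> test_functions U" for n
      by (rule test_functionsI[OF smooth_box_bump compact_cbox that])
        (use box_subset_cbox box_bump_outside in blast)
    have int: "integrable lebesgue (\<lambda>x. indicator (cbox a b) x *\<^sub>R g x)"
      using g that unfolding locally_integrable_def
      by (subst integrable_restrict_space[symmetric]) auto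
    have "(\<lambda>n. LINT x|lebesgue. g x * box_bump a b n x) \<longlonglongrightarrow> (LINT x|lebesgue. g x * indicator (box a b) x)"
    proof (rule integral_dominated_convergence[where w = "\<lambda>x. \<bar>indicator (cbox a b) x *\<^sub>R g x\<bar>"])
      have "(\<lambda>x. indicator (box a b) x *\<^sub>R (indicator (cbox a b) x *\<^sub>R g x)) \<in> borel_measurable lebesgue"
        by (intro borel_measurable_scaleR borel_measurable_indicator borel_measurable_integrable[OF int]) simp
      moreover have "(\<lambda>x. indicator (box a b) x *\<^sub>R (indicator (cbox a b) x *\<^sub>R g x)) = (\<lambda>x. g x * indicator (box a b) x)"
        using box_subset_cbox by (auto simp: indicator_def fun_eq_iff)
      ultimately show "(\<lambda>x. g x * indicator (box a b) x) \<in> borel_measurable lebesgue" by simp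
      show "(\<lambda>x. g x * box_bump a b n x) \<in> borel_measurable lebesgue" for n
        by (rule borel_measurable_integrable)
          (rule locally_integrable_mult[OF g smooth_continuous[OF smooth_box_bump] compact_cbox that],
           use box_subset_cbox box_bump_outside in blast)
      show "AE x in lebesgue. (\<lambda>n. g x * box_bump a b n x) \<longlonglongrightarrow> g x * indicator (box a b) x"
        by (intro AE_I2 tendsto_mult tendsto_const box_bump_tendsto)
      have "\<bar>g x * box_bump a b n x\<bar> \<le> \<bar>indicator (cbox a b) x *\<^sub>R g x\<bar>" for n x
      proof (cases "x \<in> box a b")
        case True
        then have "x \<in> cbox a b" using box_subset_cbox by blast
        then show ?thesis
          using box_bump_bounds[of a b n x] by (simp add: abs_mult mult_left_le)
      qed (simp add: box_bump_outside)
      then show "AE x in lebesgue. norm (g x * box_bump a b n x) \<le> \<bar>indicator (cbox a b) x *\<^sub>R g x\<bar>" for n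
        by simp
    qed (use int in auto)
    then have "(LINT x|lebesgue. g x * indicator (box a b) x) = 0"
      using zero[OF test] by (simp add: LIMSEQ_const_iff)
    then show ?thesis
      by (simp add: set_lebesgue_integral_def mult.commute)
  qed
  have cbox_AE: "AE x in lebesgue. x \<in> cbox a b \<longrightarrow> g x = 0" if ab: "cbox a b \<subseteq> U" for a b
  proof -
    have int: "integrable lebesgue (\<lambda>x. indicator (box a b) x *\<^sub>R (indicator (cbox a b) x *\<^sub>R g x))"
      by (rule integrable_mult_indicator, simp, subst integrable_restrict_space[symmetric])
        (use g that in \<open>auto simp: locally_integrable_def\<close>)
    have eq: "(\<lambda>x. indicator (box a b) x *\<^sub>R (indicator (cbox a b) x *\<^sub>R g x)) = (\<lambda>x. indicator (box a b) x *\<^sub>R g x)"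
      using box_subset_cbox[of a b] by (auto simp: indicator_def fun_eq_iff)
    have "AE x in lebesgue. indicator (box a b) x *\<^sub>R g x = 0"
    proof (rule integral_boxes_zero_imp_AE_zero)
      show "integrable lebesgue (\<lambda>x. indicator (box a b) x *\<^sub>R g x)"
        using int eq by simp
      show "(LINT x|lebesgue. indicator (box a b) x *\<^sub>R g x) = 0"
        using box0[OF ab] by (simp add: set_lebesgue_integral_def)
      fix c d :: 'a
      \<comment> \<open>The truncation to \<open>box a b\<close> is tested on arbitrary boxes. Each
        intersection is again a box, and if it is nonempty its closure stays in
        \<open>cbox a b\<close>, hence in \<open>U\<close>.\<close>
      obtain p q where pq: "box c d \<inter> box a b = box p q"
        using box_Int_box[of c d a b] by blast
      have "(LINT x:box p q|lebesgue. g x) = 0"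
      proof (cases "box p q = {}")
        case False
        have "box p q \<subseteq> cbox a b"
          using pq box_subset_cbox[of a b] by blast
        then have "cbox p q \<subseteq> U"
          using False ab closure_minimal[OF _ closed_cbox] by (metis closure_box order_trans)
        then show ?thesis by (rule box0)
      qed (simp add: set_lebesgue_integral_def)
      then show "(LINT x:box c d|lebesgue. indicator (box a b) x *\<^sub>R g x) = 0"
        unfolding set_lebesgue_integral_def pq[symmetric]
        by (simp add: indicator_inter_arith mult.assoc)
    qed
    moreover have "AE x in lebesgue. x \<notin> cbox a b - box a b"
      using negligible_frontier_interval[of a b] by (intro AE_not_in) (simp add: negligible_iff_null_sets)
    ultimately show ?thesis
      by eventually_elim (auto simp: indicator_def split: if_splits)
  qed
  obtain D where D: "countable D" "D \<subseteq> Pow U" "\<And>X. X \<in> D \<Longrightarrow> \<exists>a b. X = cbox a b" "\<Union>D = U"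
    using open_countable_Union_open_cbox[OF \<open>open U\<close>] by metis
  have "AE x in lebesgue. \<forall>X\<in>D. x \<in> X \<longrightarrow> g x = 0"
    unfolding AE_ball_countable[OF D(1)]
  proof
    fix X assume "X \<in> D"
    moreover from this obtain a b where "X = cbox a b" using D(3) by blast
    ultimately show "AE x in lebesgue. x \<in> X \<longrightarrow> g x = 0"
      using cbox_AE[of a b] D(2) by auto
  qed
  then show ?thesis
    using D(4) by (auto elim!: eventually_mono)
qed

section \<open>Weak gradients and the capacity\<close>

definition grad :: "('a::euclidean_space \<Rightarrow> real) \<Rightarrow> 'a \<Rightarrow> 'a" where
  "grad f x = (\<Sum>i\<in>Basis. frechet_derivative f (at x) i *\<^sub>R i)"

lemma grad_inner_Basis: "i \<in> Basis \<Longrightarrow> grad f x \<bullet> i = frechet_derivative f (at x) i"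
  by (simp add: grad_def inner_sum_left inner_Basis if_distrib cong: if_cong)

lemma smooth_has_derivative_grad:
  assumes "smooth f"
  shows "(f has_derivative (\<lambda>h. grad f x \<bullet> h)) (at x)"
proof -
  have lin: "linear (frechet_derivative f (at x))"
    using smooth_has_derivative[OF assms] has_derivative_linear by blast
  have "frechet_derivative f (at x) h = grad f x \<bullet> h" for h
  proof -
    have "frechet_derivative f (at x) h = frechet_derivative f (at x) (\<Sum>i\<in>Basis. (h \<bullet> i) *\<^sub>R i)"
      by (simp add: euclidean_representation)
    also have "\<dots> = (\<Sum>i\<in>Basis. (h \<bullet> i) * frechet_derivative f (at x) i)"
      using lin by (simp add: linear_sum linear_scale)
    also have "\<dots> = grad f x \<bullet> h"
      by (simp add: grad_def inner_sum_left inner_commute[of h] mult.commute)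
    finally show ?thesis .
  qed
  then have "frechet_derivative f (at x) = (\<lambda>h. grad f x \<bullet> h)" by auto
  then show ?thesis
    using smooth_has_derivative[OF assms, of x] by simp
qed

lemma grad_eqI:
  assumes "(f has_derivative (\<lambda>h. v \<bullet> h)) (at x)"
  shows "grad f x = v"
  using frechet_derivative_at[OF assms, symmetric]
  by (simp add: grad_def euclidean_representation)

lemma grad_const_open:
  "open V \<Longrightarrow> x \<in> V \<Longrightarrow> (\<And>y. y \<in> V \<Longrightarrow> f y = c) \<Longrightarrow> grad f x = 0"
  unfolding grad_def by (subst frechet_derivative_const_open) auto

lemma continuous_grad: "smooth f \<Longrightarrow> continuous_on S (grad f)"
  unfolding grad_def
  by (intro continuous_intros smooth_continuous smooth_partial)

lemma grad_test_function_outside: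
  assumes "\<phi> \<in> test_functions U"
  obtains C where "compact C" "C \<subseteq> U" "\<And>x. x \<notin> C \<Longrightarrow> \<phi> x = 0" "\<And>x. x \<notin> C \<Longrightarrow> grad \<phi> x = 0"
proof -
  obtain C where C: "compact C" "C \<subseteq> U" "\<And>x. x \<notin> C \<Longrightarrow> \<phi> x = 0"
    by (rule test_functionsE[OF assms]) blast
  moreover have "grad \<phi> x = 0" if "x \<notin> C" for x
    by (rule grad_const_open[of "- C" _ _ 0]) (use that C in \<open>auto simp: compact_imp_closed open_Compl\<close>)
  ultimately show ?thesis using that by blast
qed

section \<open>Classical and weak gradients\<close>

text \<open>Differentiating the translation-invariant integral of \<open>u\<close> in the direction \<open>i\<close>.\<close>

lemma integral_partial_test_function:
  fixes u :: "'a::euclidean_space \<Rightarrow> real"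
  assumes u: "u \<in> test_functions UNIV" and i: "i \<in> Basis"
  shows "(LINT x|lebesgue. frechet_derivative u (at x) i) = 0"
proof -
  obtain C where C: "compact C" "\<And>x. x \<notin> C \<Longrightarrow> u x = 0" "\<And>x. x \<notin> C \<Longrightarrow> grad u x = 0"
    by (rule grad_test_function_outside[OF u]) blast
  note sm = test_functionsD(1)[OF u]
  define D where "D = (\<lambda>x. frechet_derivative u (at x) i)"
  have D_grad: "D x = grad u x \<bullet> i" for x
    by (simp add: D_def grad_inner_Basis i)
  have D_cont: "continuous_on UNIV D"
    unfolding D_def by (intro smooth_continuous smooth_partial sm i)
  have u_cont: "continuous_on UNIV u"
    by (rule smooth_continuous[OF sm])
  obtain B where B: "B > 0" "\<And>x. norm (D x) \<le> B"
    by (rule continuous_compact_support_bounded[OF D_cont C(1)]) (auto simp: D_grad C(3))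
  define t where "t = (\<lambda>n. inverse (real (Suc n)))"
  have t: "t n > 0" "t n \<le> 1" for n
    unfolding t_def by (auto simp: field_simps)
  define Q where "Q = (\<lambda>n x. (u (t n *\<^sub>R i + x) - u x) / t n)"
  have deriv: "((\<lambda>s. u (s *\<^sub>R i + x)) has_real_derivative D (s *\<^sub>R i + x)) (at s)" for s x
  proof -
    have "((\<lambda>s. s *\<^sub>R i + x) has_derivative (\<lambda>s. s *\<^sub>R i)) (at s)"
      by (auto intro!: derivative_eq_intros)
    from has_derivative_compose[OF this smooth_has_derivative_grad[OF sm]]
    have "((\<lambda>s. u (s *\<^sub>R i + x)) has_derivative (\<lambda>r. grad u (s *\<^sub>R i + x) \<bullet> (r *\<^sub>R i))) (at s)" .
    then show ?thesis
      by (rule has_derivative_imp_has_field_derivative) (simp add: D_grad)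
  qed
  have Q_bound: "\<bar>Q n x\<bar> \<le> B" for n x
  proof -
    obtain z where "u (t n *\<^sub>R i + x) - u (0 *\<^sub>R i + x) = (t n - 0) * D (z *\<^sub>R i + x)"
      using MVT2[OF t(1)[of n] deriv] by metis
    then have "Q n x = D (z *\<^sub>R i + x)"
      using t(1)[of n] by (simp add: Q_def)
    then show ?thesis using B(2) by simp
  qed
  \<comment> \<open>All steps \<open>t n\<close> lie in \<open>{0..1}\<close>, so this single
    compact set contains the supports of all difference quotients. Together with the mean value
    bound \<open>B\<close> it gives the dominating function.\<close>
  define C' where "C' = {x - y | x y. x \<in> C \<and> y \<in> (\<lambda>s. s *\<^sub>R i) ` {0..1}}"
  have C': "compact C'"
    unfolding C'_def by (intro compact_differences C compact_continuous_image continuous_intros compact_Icc)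
  have Q_out: "Q n x = 0" if "x \<notin> C'" for n x
  proof -
    have "x \<notin> C"
    proof
      assume "x \<in> C"
      moreover have "x = x - 0 *\<^sub>R i" by simp
      moreover have "(0::real) \<in> {0..1}" by simp
      ultimately have "x \<in> C'" unfolding C'_def by blast
      then show False using that by simp
    qed
    moreover have "t n *\<^sub>R i + x \<notin> C"
    proof
      assume "t n *\<^sub>R i + x \<in> C"
      moreover have "x = (t n *\<^sub>R i + x) - t n *\<^sub>R i" by simp
      moreover have "t n \<in> {0..1}" using t[of n] by auto
      ultimately have "x \<in> C'" unfolding C'_def by blast
      then show False using that by simp
    qed
    ultimately show ?thesis by (simp add: Q_def C)
  qed
  have Q_cont: "continuous_on UNIV (Q n)" for n
    unfolding Q_def using t(1)[of n]
    by (intro continuous_intros continuous_on_compose2[OF u_cont]) auto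
  have "integral\<^sup>L lborel (Q n) = 0" for n
  proof -
    have u_int: "integrable lborel u"
      by (rule continuous_compact_support_integrable(1)[OF u_cont C(1)]) (rule C(2))
    have meas: "u \<in> borel_measurable borel"
      using u_int by simp
    have tr: "integrable lborel (\<lambda>x. u (t n *\<^sub>R i + x))"
      "(LINT x|lborel. u (t n *\<^sub>R i + x)) = integral\<^sup>L lborel u"
      using integrable_distr_eq[of "(+) (t n *\<^sub>R i)" lborel borel u]
        integral_distr[of "(+) (t n *\<^sub>R i)" lborel borel u] meas u_int
      by (simp_all add: lborel_distr_plus)
    show ?thesis
      unfolding Q_def using tr u_int by simp
  qed
  moreover have "(\<lambda>n. integral\<^sup>L lborel (Q n)) \<longlonglongrightarrow> integral\<^sup>L lborel D"
  proof (rule integral_dominated_convergence[where w = "\<lambda>x. indicator C' x *\<^sub>R B"])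
    show "D \<in> borel_measurable lborel" "Q n \<in> borel_measurable lborel" for n
      using D_cont Q_cont by (auto intro: borel_measurable_continuous_onI)
    show "integrable lborel (\<lambda>x. indicator C' x *\<^sub>R B)"
      by (rule borel_integrable_compact[OF C']) simp
    show "AE x in lborel. norm (Q n x) \<le> indicator C' x *\<^sub>R B" for n
      using Q_bound Q_out by (auto simp: indicator_def)
    have "(\<lambda>n. Q n x) \<longlonglongrightarrow> D x" for x
    proof -
      have "((\<lambda>h. (u ((0 + h) *\<^sub>R i + x) - u (0 *\<^sub>R i + x)) / h) \<longlongrightarrow> D (0 *\<^sub>R i + x)) (at 0)"
        using deriv[of x 0] unfolding DERIV_def .
      moreover have "filterlim t (at 0) sequentially"
        unfolding t_def filterlim_at
        using LIMSEQ_inverse_real_of_nat by (auto intro!: always_eventually)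
      ultimately show ?thesis
        unfolding Q_def by (auto dest: filterlim_compose)
    qed
    then show "AE x in lborel. (\<lambda>n. Q n x) \<longlonglongrightarrow> D x" by simp
  qed
  ultimately have "integral\<^sup>L lborel D = 0"
    by (simp add: LIMSEQ_const_iff)
  then show ?thesis
    unfolding D_def[symmetric]
    by (subst integral_completion) (use D_cont in \<open>auto intro: borel_measurable_continuous_onI\<close>)
qed

text \<open>The product of \<open>f\<close> with a test function is again a test function, so its
  partial derivatives have integral 0; the product rule then yields integration by parts.\<close>

lemma has_weak_gradient_smooth:
  assumes "open U" "smooth f"
  shows "has_weak_gradient U f (grad f)"
  unfolding has_weak_gradient_def
proof (intro conjI ballI)
  show "locally_integrable U f" "locally_integrable U (grad f)"
    by (simp_all add: continuous_locally_integrable smooth_continuous continuous_grad assms)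
  fix \<phi> :: "'a \<Rightarrow> real" and i :: 'a assume \<phi>: "\<phi> \<in> test_functions U" and i: "i \<in> Basis"
  obtain C where C: "compact C" "C \<subseteq> U" "\<And>x. x \<notin> C \<Longrightarrow> \<phi> x = 0" "\<And>x. x \<notin> C \<Longrightarrow> grad \<phi> x = 0"
    by (rule grad_test_function_outside[OF \<phi>]) blast
  note sm = test_functionsD(1)[OF \<phi>]
  have test: "(\<lambda>x. f x * \<phi> x) \<in> test_functions UNIV"
    using test_functions_mono[OF test_functions_mult_smooth[OF assms(2) \<phi>]] by simp
  have deriv: "frechet_derivative (\<lambda>x. f x * \<phi> x) (at x) i =
      f x * frechet_derivative \<phi> (at x) i + (grad f x \<bullet> i) * \<phi> x" for x
    using frechet_derivative_at[OF has_derivative_mult[OF smooth_has_derivative[OF assms(2)] smooth_has_derivative[OF sm]], of x]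
    by (simp add: grad_inner_Basis i fun_eq_iff)
  have int1: "integrable lebesgue (\<lambda>x. f x * frechet_derivative \<phi> (at x) i)"
    using C(4) i
    by (intro continuous_compact_support_integrable(2)[OF _ C(1)] continuous_intros smooth_continuous smooth_partial sm assms)
      (simp_all flip: grad_inner_Basis)
  have int2: "integrable lebesgue (\<lambda>x. (grad f x \<bullet> i) * \<phi> x)"
    using C(3) i
    by (intro continuous_compact_support_integrable(2)[OF _ C(1)] continuous_intros smooth_continuous continuous_grad sm assms) simp_all
  have "(LINT x|lebesgue. f x * frechet_derivative \<phi> (at x) i) + (LINT x|lebesgue. (grad f x \<bullet> i) * \<phi> x) = 0"
    using integral_partial_test_function[OF test i] int1 int2 by (simp add: deriv)
  moreover have "(LINT x|lebesgue_on U. f x * frechet_derivative \<phi> (at x) i) = (LINT x|lebesgue. f x * frechet_derivative \<phi> (at x) i)"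
    using test_functionsD(4)[OF test_functions_partial[OF \<phi> i]] by (intro lebesgue_on_zero_outside assms) simp
  moreover have "(LINT x|lebesgue_on U. (grad f x \<bullet> i) * \<phi> x) = (LINT x|lebesgue. (grad f x \<bullet> i) * \<phi> x)"
    using C(2,3) by (intro lebesgue_on_zero_outside assms) auto
  ultimately show "(LINT x|lebesgue_on U. f x * frechet_derivative \<phi> (at x) i) = - (LINT x|lebesgue_on U. (grad f x \<bullet> i) * \<phi> x)"
    by simp
qed

lemma has_weak_gradient_iff:
  assumes "open U"
  shows "has_weak_gradient U f g \<longleftrightarrow>
     locally_integrable U f \<and> locally_integrable U g \<and>
     (\<forall>\<phi>\<in>test_functions U. \<forall>i\<in>Basis.
        (LINT x|lebesgue. f x * frechet_derivative \<phi> (at x) i) = - (LINT x|lebesgue. (g x \<bullet> i) * \<phi> x))"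
proof -
  have "(LINT x|lebesgue_on U. f x * frechet_derivative \<phi> (at x) i) = (LINT x|lebesgue. f x * frechet_derivative \<phi> (at x) i)"
    "(LINT x|lebesgue_on U. (g x \<bullet> i) * \<phi> x) = (LINT x|lebesgue. (g x \<bullet> i) * \<phi> x)"
    if "\<phi> \<in> test_functions U" "i \<in> Basis" for \<phi> i
    using that test_functionsD(4)[OF test_functions_partial[OF that]] test_functionsD(4)[OF that(1)]
    by (auto intro!: lebesgue_on_zero_outside assms)
  then show ?thesis
    unfolding has_weak_gradient_def by auto
qed

lemma weak_gradient_integrands_integrable:
  assumes "open U" "has_weak_gradient U f g" "\<phi> \<in> test_functions U" "i \<in> Basis"
  shows "integrable lebesgue (\<lambda>x. f x * frechet_derivative \<phi> (at x) i)"
    "integrable lebesgue (\<lambda>x. (g x \<bullet> i) * \<phi> x)"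
proof -
  obtain C where C: "compact C" "C \<subseteq> U" "\<And>x. x \<notin> C \<Longrightarrow> \<phi> x = 0" "\<And>x. x \<notin> C \<Longrightarrow> grad \<phi> x = 0"
    by (rule grad_test_function_outside[OF assms(3)]) blast
  note sm = test_functionsD(1)[OF assms(3)]
  show "integrable lebesgue (\<lambda>x. f x * frechet_derivative \<phi> (at x) i)"
    using assms C by (intro locally_integrable_mult[OF _ _ C(1,2)] smooth_continuous smooth_partial sm)
      (auto simp: has_weak_gradient_def simp flip: grad_inner_Basis)
  show "integrable lebesgue (\<lambda>x. (g x \<bullet> i) * \<phi> x)"
    using assms C by (intro locally_integrable_mult[OF _ _ C(1,2)] smooth_continuous sm locally_integrable_inner)
      (auto simp: has_weak_gradient_def)
qed

lemma has_weak_gradient_diff: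
  assumes "open U" "has_weak_gradient U f g" "has_weak_gradient U f' g'"
  shows "has_weak_gradient U (\<lambda>x. f x - f' x) (\<lambda>x. g x - g' x)"
  unfolding has_weak_gradient_iff[OF assms(1)]
proof (intro conjI ballI)
  show "locally_integrable U (\<lambda>x. f x - f' x)" "locally_integrable U (\<lambda>x. g x - g' x)"
    using assms(2,3) by (auto simp: has_weak_gradient_def intro: locally_integrable_diff)
  fix \<phi> :: "'a \<Rightarrow> real" and i :: 'a assume \<phi>: "\<phi> \<in> test_functions U" and i: "i \<in> Basis"
  show "(LINT x|lebesgue. (f x - f' x) * frechet_derivative \<phi> (at x) i) = - (LINT x|lebesgue. ((g x - g' x) \<bullet> i) * \<phi> x)"
    using assms(2,3) \<phi> i
      weak_gradient_integrands_integrable[OF assms(1,2) \<phi> i] weak_gradient_integrands_integrable[OF assms(1,3) \<phi> i]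
    by (simp add: has_weak_gradient_iff[OF assms(1)] left_diff_distrib inner_diff_left)
qed

lemma has_weak_gradient_subset:
  assumes "open U" "open V" "V \<subseteq> U" "has_weak_gradient U f g"
  shows "has_weak_gradient V f g"
  using assms(4) test_functions_mono[OF _ assms(3)] locally_integrable_subset[OF _ assms(3), of f]
    locally_integrable_subset[OF _ assms(3), of g]
  unfolding has_weak_gradient_iff[OF assms(1)] has_weak_gradient_iff[OF assms(2)] by blast

text \<open>Each component of the difference of two weak gradients is orthogonal to all test
  functions, so the fundamental lemma applies. This makes the choice inside
  \<open>weak_gradient\<close> harmless: the energy can be computed from any weak gradient.\<close>

lemma has_weak_gradient_unique:
  assumes "open U" "has_weak_gradient U f g" "has_weak_gradient U f g'"
  shows "AE x in lebesgue. x \<in> U \<longrightarrow> g x = g' x"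
proof -
  have "AE x in lebesgue. \<forall>i\<in>Basis. x \<in> U \<longrightarrow> (g x - g' x) \<bullet> i = 0"
  proof (rule AE_finite_allI)
    fix i :: 'a assume i: "i \<in> Basis"
    show "AE x in lebesgue. x \<in> U \<longrightarrow> (g x - g' x) \<bullet> i = 0"
    proof (rule fundamental_lemma_calculus_of_variations[OF assms(1)])
      show "locally_integrable U (\<lambda>x. (g x - g' x) \<bullet> i)"
        using assms(2,3) by (auto simp: has_weak_gradient_def intro: locally_integrable_diff locally_integrable_inner)
      show "(LINT x|lebesgue. (g x - g' x) \<bullet> i * \<phi> x) = 0" if "\<phi> \<in> test_functions U" for \<phi>
        using has_weak_gradient_diff[OF assms] that i by (simp add: has_weak_gradient_iff[OF assms(1)])
    qed
  qed simp
  then show ?thesis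
  proof eventually_elim
    case (elim x)
    show ?case
    proof
      assume "x \<in> U"
      with elim have "\<forall>i\<in>Basis. g x \<bullet> i = g' x \<bullet> i"
        by (simp add: inner_diff_left)
      then show "g x = g' x" by (simp add: euclidean_eq_iff[where 'a='a])
    qed
  qed
qed

lemma weak_gradient_AE:
  assumes "open U" "has_weak_gradient U f g"
  shows "has_weak_gradient U f (weak_gradient U f)"
    "AE x in lebesgue. x \<in> U \<longrightarrow> weak_gradient U f x = g x"
proof -
  show "has_weak_gradient U f (weak_gradient U f)"
    unfolding weak_gradient_def by (rule someI[of "has_weak_gradient U f", OF assms(2)])
  from has_weak_gradient_unique[OF assms(1) this assms(2)]
  show "AE x in lebesgue. x \<in> U \<longrightarrow> weak_gradient U f x = g x" .
qed

section \<open>Square integrability, and test functions as Sobolev functions\<close>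

lemma borel_measurable_lebesgue_on_AE:
  fixes f g :: "'a::euclidean_space \<Rightarrow> 'b::euclidean_space"
  assumes "S \<in> sets lebesgue" "f \<in> borel_measurable (lebesgue_on S)"
    and "AE x in lebesgue. x \<in> S \<longrightarrow> f x = g x"
  shows "g \<in> borel_measurable (lebesgue_on S)"
proof -
  have "(\<lambda>x. indicator S x *\<^sub>R f x) \<in> borel_measurable lebesgue"
    using assms by (subst borel_measurable_restrict_space_iff[symmetric]) auto
  moreover have "AE x in lebesgue. indicator S x *\<^sub>R f x = indicator S x *\<^sub>R g x"
    using assms(3) by eventually_elim (auto simp: indicator_def)
  ultimately have "(\<lambda>x. indicator S x *\<^sub>R g x) \<in> borel_measurable lebesgue"
    by (rule borel_measurable_AE)
  then show ?thesis
    using assms by (subst borel_measurable_restrict_space_iff) auto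
qed

lemma square_integrable_AE:
  fixes f g :: "'a::euclidean_space \<Rightarrow> 'b::euclidean_space"
  assumes "S \<in> sets lebesgue" "square_integrable S f" "AE x in lebesgue. x \<in> S \<longrightarrow> f x = g x"
  shows "square_integrable S g"
    "(LINT x|lebesgue_on S. (norm (g x))\<^sup>2) = (LINT x|lebesgue_on S. (norm (f x))\<^sup>2)"
proof -
  have f: "f \<in> borel_measurable (lebesgue_on S)" "integrable (lebesgue_on S) (\<lambda>x. (norm (f x))\<^sup>2)"
    using assms(2) by (auto simp: square_integrable_def)
  have g: "g \<in> borel_measurable (lebesgue_on S)"
    using borel_measurable_lebesgue_on_AE[OF assms(1) f(1) assms(3)] .
  have AE: "AE x in lebesgue_on S. (norm (g x))\<^sup>2 = (norm (f x))\<^sup>2"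
    using assms(1,3) by (subst AE_restrict_space_iff) (auto elim!: eventually_mono)
  show "square_integrable S g"
    unfolding square_integrable_def
  proof
    show "integrable (lebesgue_on S) (\<lambda>x. (norm (g x))\<^sup>2)"
      using f g by (subst integrable_cong_AE[OF _ _ AE]) auto
  qed fact
  show "(LINT x|lebesgue_on S. (norm (g x))\<^sup>2) = (LINT x|lebesgue_on S. (norm (f x))\<^sup>2)"
    using f g by (intro integral_cong_AE AE) auto
qed

lemma continuous_compact_support_square_integrable:
  fixes h :: "'a::euclidean_space \<Rightarrow> 'b::euclidean_space"
  assumes "continuous_on UNIV h" "compact C" "\<And>x. x \<notin> C \<Longrightarrow> h x = 0" "S \<in> sets lebesgue"
  shows "square_integrable S h"
  unfolding square_integrable_def
proof
  show "h \<in> borel_measurable (lebesgue_on S)"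
    using continuous_borel_measurable_lebesgue[OF assms(1)] by (rule measurable_restrict_space1)
  have "integrable lebesgue (\<lambda>x. (norm (h x))\<^sup>2)"
    by (rule continuous_compact_support_integrable(2)[OF _ assms(2)])
      (use assms(1,3) in \<open>auto intro!: continuous_intros\<close>)
  then show "integrable (lebesgue_on S) (\<lambda>x. (norm (h x))\<^sup>2)"
    by (subst integrable_restrict_space) (use assms(4) in \<open>auto intro!: integrable_mult_indicator[where 'b = real, simplified]\<close>)
qed

lemma test_function_square_integrable:
  assumes "\<phi> \<in> test_functions U" "S \<in> sets lebesgue"
  shows "square_integrable S \<phi>" "square_integrable S (grad \<phi>)"
proof -
  obtain C where C: "compact C" "\<And>x. x \<notin> C \<Longrightarrow> \<phi> x = 0" "\<And>x. x \<notin> C \<Longrightarrow> grad \<phi> x = 0"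
    by (rule grad_test_function_outside[OF assms(1)]) blast
  show "square_integrable S \<phi>" "square_integrable S (grad \<phi>)"
    using C test_functionsD(1)[OF assms(1)]
    by (auto intro!: continuous_compact_support_square_integrable[OF _ C(1) _ assms(2)] smooth_continuous continuous_grad)
qed

lemma square_integrable_diff:
  fixes f g :: "'a::euclidean_space \<Rightarrow> 'b::euclidean_space"
  assumes "square_integrable S f" "square_integrable S g"
  shows "square_integrable S (\<lambda>x. f x - g x)"
  unfolding square_integrable_def
proof
  show m: "(\<lambda>x. f x - g x) \<in> borel_measurable (lebesgue_on S)"
    using assms by (auto simp: square_integrable_def)
  have "integrable (lebesgue_on S) (\<lambda>x. 2 * (norm (f x))\<^sup>2 + 2 * (norm (g x))\<^sup>2)"
    using assms by (auto simp: square_integrable_def)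
  then show "integrable (lebesgue_on S) (\<lambda>x. (norm (f x - g x))\<^sup>2)"
  proof (rule Bochner_Integration.integrable_bound)
    have "(norm (f x - g x))\<^sup>2 \<le> 2 * (norm (f x))\<^sup>2 + 2 * (norm (g x))\<^sup>2" for x
    proof -
      have "(norm (f x - g x))\<^sup>2 \<le> (norm (f x) + norm (g x))\<^sup>2"
        by (intro power_mono norm_triangle_ineq4) simp
      also have "\<dots> \<le> 2 * (norm (f x))\<^sup>2 + 2 * (norm (g x))\<^sup>2"
        using sum_squares_bound[of "norm (f x)" "norm (g x)"] by (simp add: power2_sum)
      finally show ?thesis .
    qed
    then show "AE x in lebesgue_on S. norm ((norm (f x - g x))\<^sup>2) \<le> norm (2 * (norm (f x))\<^sup>2 + 2 * (norm (g x))\<^sup>2)"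
      by (simp add: abs_of_nonneg)
  qed (use m in measurable)
qed

lemma square_integrable_subset:
  fixes f :: "'a::euclidean_space \<Rightarrow> 'b::euclidean_space"
  assumes "square_integrable S f" "T \<subseteq> S" "S \<in> sets lebesgue" "T \<in> sets lebesgue"
  shows "square_integrable T f"
    "(LINT x|lebesgue_on T. (norm (f x))\<^sup>2) \<le> (LINT x|lebesgue_on S. (norm (f x))\<^sup>2)"
proof -
  have f: "f \<in> borel_measurable (lebesgue_on S)" "integrable lebesgue (\<lambda>x. indicator S x *\<^sub>R (norm (f x))\<^sup>2)"
    using assms by (simp_all add: square_integrable_def integrable_restrict_space)
  have "integrable lebesgue (\<lambda>x. indicator T x *\<^sub>R (indicator S x *\<^sub>R (norm (f x))\<^sup>2))"
    by (rule integrable_mult_indicator[OF assms(4) f(2)])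
  moreover have "(\<lambda>x. indicator T x *\<^sub>R (indicator S x *\<^sub>R (norm (f x))\<^sup>2)) = (\<lambda>x. indicator T x *\<^sub>R (norm (f x))\<^sup>2)"
    using assms(2) by (auto simp: indicator_def fun_eq_iff)
  ultimately have int: "integrable lebesgue (\<lambda>x. indicator T x *\<^sub>R (norm (f x))\<^sup>2)"
    by simp
  moreover have "f \<in> borel_measurable (lebesgue_on T)"
    using f(1) assms(2) by (rule measurable_restrict_mono)
  ultimately show "square_integrable T f"
    using assms(4) by (simp add: square_integrable_def integrable_restrict_space)
  have "(LINT x|lebesgue. indicator T x *\<^sub>R (norm (f x))\<^sup>2) \<le> (LINT x|lebesgue. indicator S x *\<^sub>R (norm (f x))\<^sup>2)"
    using assms(2) by (intro integral_mono[OF int f(2)]) (auto simp: indicator_def)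
  then show "(LINT x|lebesgue_on T. (norm (f x))\<^sup>2) \<le> (LINT x|lebesgue_on S. (norm (f x))\<^sup>2)"
    using assms(3,4) by (simp add: integral_restrict_space)
qed

lemma test_function_dirichlet:
  assumes "open U" "\<phi> \<in> test_functions U"
  shows "(LINT x|lebesgue_on U. (norm (weak_gradient U \<phi> x))\<^sup>2) = (LINT x|lebesgue. (norm (grad \<phi> x))\<^sup>2)"
proof -
  have "AE x in lebesgue. x \<in> U \<longrightarrow> grad \<phi> x = weak_gradient U \<phi> x"
    using weak_gradient_AE(2)[OF assms(1) has_weak_gradient_smooth[OF assms(1) test_functionsD(1)[OF assms(2)]]]
    by eventually_elim auto
  then have "(LINT x|lebesgue_on U. (norm (weak_gradient U \<phi> x))\<^sup>2) = (LINT x|lebesgue_on U. (norm (grad \<phi> x))\<^sup>2)"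
    using assms(1) by (intro square_integrable_AE(2)[OF _ test_function_square_integrable(2)[OF assms(2)]]) auto
  also have "\<dots> = (LINT x|lebesgue. (norm (grad \<phi> x))\<^sup>2)"
  proof -
    obtain C where C: "C \<subseteq> U" "\<And>x. x \<notin> C \<Longrightarrow> grad \<phi> x = 0"
      by (rule grad_test_function_outside[OF assms(2)]) blast
    have "grad \<phi> x = 0" if "x \<notin> U" for x
      using C that by blast
    then show ?thesis
      by (intro lebesgue_on_zero_outside assms) simp
  qed
  finally show ?thesis .
qed

lemma test_function_H10:
  assumes "open U" "\<phi> \<in> test_functions U"
  shows "\<phi> \<in> H10 U"
proof -
  \<comment> \<open>The approximating sequence is constantly \<open>\<phi>\<close>. Even so, the
    \<open>H1_norm\<close> of the zero function needs an argument, since its chosen weak gradient is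
    only known to vanish almost everywhere on \<open>U\<close>.\<close>
  have "(\<lambda>_::'a. 0) \<in> test_functions U"
    by (rule test_functionsI[of _ "{}"]) (auto intro: smooth_const)
  then have "(LINT x|lebesgue_on U. (norm (weak_gradient U (\<lambda>_. 0) x))\<^sup>2) = (LINT x|lebesgue. (norm (grad (\<lambda>_::'a. 0) x))\<^sup>2)"
    by (rule test_function_dirichlet[OF assms(1)])
  also have "\<dots> = 0"
    using grad_const_open[of UNIV _ "\<lambda>_::'a. 0" 0] by simp
  finally have "H1_norm U (\<lambda>x. \<phi> x - \<phi> x) = 0"
    by (simp add: H1_norm_def)
  moreover have "\<phi> \<in> H1 U"
    using test_function_square_integrable[OF assms(2)] assms(1) test_functionsD(1)[OF assms(2)]
    by (auto simp: H1_def intro!: exI[of _ "grad \<phi>"] has_weak_gradient_smooth)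
  ultimately show ?thesis
    using assms(2) test_functionsD(4)[OF assms(2)] by (auto simp: H10_def intro!: exI[of _ "\<lambda>_. \<phi>"])
qed

section \<open>Reduction of the capacity to smooth functions equal to 1 near the compact set\<close>

lemma power2_norm_diff_le:
  fixes a d :: "'a::real_normed_vector"
  assumes "t > 0"
  shows "(norm (a - d))\<^sup>2 \<le> (1 + t) * (norm a)\<^sup>2 + (1 + 1 / t) * (norm d)\<^sup>2"
proof -
  have "0 \<le> (t * norm a - norm d)\<^sup>2 / t"
    using assms by simp
  also have "\<dots> = t * (norm a)\<^sup>2 + (norm d)\<^sup>2 / t - 2 * norm a * norm d"
    using assms by (simp add: power2_diff power_mult_distrib field_simps power2_eq_square)
  finally have "(norm a + norm d)\<^sup>2 \<le> (1 + t) * (norm a)\<^sup>2 + (1 + 1 / t) * (norm d)\<^sup>2"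
    by (simp add: power2_sum algebra_simps)
  moreover have "(norm (a - d))\<^sup>2 \<le> (norm a + norm d)\<^sup>2"
    by (intro power_mono norm_triangle_ineq4) simp
  ultimately show ?thesis by linarith
qed

text \<open>The test functions equal to 1 near \<open>K\<close> are dense in the admissible class as far as the
  energy outside \<open>K\<close> is concerned, and on \<open>K\<close> their gradients vanish.\<close>

lemma dirichlet_ge_of_test_functions:
  assumes \<Omega>: "open \<Omega>" and K: "compact K" and \<eta>: "is_cutoff \<Omega> K \<eta>"
    and f: "f \<in> H10 \<Omega>" "(\<lambda>x. f x - \<eta> x) \<in> H10 (\<Omega> - K)"
    and B: "\<And>u V. u \<in> test_functions \<Omega> \<Longrightarrow> open V \<Longrightarrow> K \<subseteq> V \<Longrightarrow> (\<And>x. x \<in> V \<Longrightarrow> u x = 1) \<Longrightarrow>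
        B \<le> (LINT x|lebesgue. (norm (grad u x))\<^sup>2)"
  shows "B \<le> (LINT x|lebesgue_on \<Omega>. (norm (weak_gradient \<Omega> f x))\<^sup>2)"
proof -
  define U where "U = \<Omega> - K"
  have U: "open U" "U \<subseteq> \<Omega>" "U \<in> sets lebesgue" "\<Omega> \<in> sets lebesgue"
    unfolding U_def using \<Omega> K by (auto simp: compact_imp_closed open_Diff)
  define G where "G = weak_gradient \<Omega> f"
  obtain g where g: "has_weak_gradient \<Omega> f g" "square_integrable \<Omega> g"
    using f(1) by (auto simp: H10_def H1_def)
  have G: "has_weak_gradient \<Omega> f G" "AE x in lebesgue. x \<in> \<Omega> \<longrightarrow> G x = g x"
    unfolding G_def by (rule weak_gradient_AE[OF \<Omega> g(1)])+
  have "AE x in lebesgue. x \<in> \<Omega> \<longrightarrow> g x = G x"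
    using G(2) by eventually_elim auto
  then have G_sq: "square_integrable \<Omega> G"
    by (rule square_integrable_AE(1)[OF U(4) g(2)])
  have G_sq_U: "square_integrable U G"
    and E_le: "(LINT x|lebesgue_on U. (norm (G x))\<^sup>2) \<le> (LINT x|lebesgue_on \<Omega>. (norm (G x))\<^sup>2)"
    using square_integrable_subset[OF G_sq U(2,4,3)] by auto
  define E where "E = (LINT x|lebesgue_on U. (norm (G x))\<^sup>2)"
  obtain \<phi> where \<phi>: "\<And>n::nat. \<phi> n \<in> test_functions U"
    and lim: "(\<lambda>n. H1_norm U (\<lambda>x. f x - \<eta> x - \<phi> n x)) \<longlonglongrightarrow> 0"
    using f(2) by (auto simp: H10_def U_def)
  obtain V where V: "\<eta> \<in> test_functions \<Omega>" "open V" "K \<subseteq> V" "\<And>x. x \<in> V \<Longrightarrow> \<eta> x = 1"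
    using \<eta> by (auto simp: is_cutoff_def)
  define u where "u = (\<lambda>n x. \<eta> x + \<phi> n x)"
  have u_test: "u n \<in> test_functions \<Omega>" for n
    unfolding u_def by (rule test_functions_add[OF V(1) test_functions_mono[OF \<phi> U(2)]])
  define e where "e = (\<lambda>n. LINT x|lebesgue_on U. (norm (G x - grad (u n) x))\<^sup>2)"
  have d_sq: "square_integrable U (\<lambda>x. G x - grad (u n) x)" for n
    by (rule square_integrable_diff[OF G_sq_U test_function_square_integrable(2)[OF u_test U(3)]])
  have e_nonneg: "0 \<le> e n" for n
    unfolding e_def by (rule Bochner_Integration.integral_nonneg) simp
  have e_le: "e n \<le> (H1_norm U (\<lambda>x. f x - \<eta> x - \<phi> n x))\<^sup>2" for n
  proof -
    have "has_weak_gradient U (\<lambda>x. f x - u n x) (\<lambda>x. G x - grad (u n) x)"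
      by (intro has_weak_gradient_diff U has_weak_gradient_smooth test_functionsD(1)[OF u_test]
          has_weak_gradient_subset[OF \<Omega> U(1,2) G(1)])
    from weak_gradient_AE(2)[OF U(1) this]
    have "AE x in lebesgue. x \<in> U \<longrightarrow> G x - grad (u n) x = weak_gradient U (\<lambda>x. f x - u n x) x"
      by eventually_elim auto
    from square_integrable_AE(2)[OF U(3) d_sq this]
    have "e n = (LINT x|lebesgue_on U. (norm (weak_gradient U (\<lambda>x. f x - u n x) x))\<^sup>2)"
      unfolding e_def by simp
    also have "\<dots> \<le> (LINT x|lebesgue_on U. (f x - u n x)\<^sup>2) + \<dots>"
      by (simp add: Bochner_Integration.integral_nonneg)
    also have "\<dots> = (H1_norm U (\<lambda>x. f x - u n x))\<^sup>2"
      unfolding H1_norm_def by (subst real_sqrt_pow2) (auto intro!: add_nonneg_nonneg Bochner_Integration.integral_nonneg)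
    finally show ?thesis by (simp add: u_def diff_diff_eq)
  qed
  have e_lim: "e \<longlonglongrightarrow> 0"
  proof (rule tendsto_sandwich[where f = "\<lambda>_. 0"])
    show "(\<lambda>n. (H1_norm U (\<lambda>x. f x - \<eta> x - \<phi> n x))\<^sup>2) \<longlonglongrightarrow> 0"
      using tendsto_power[OF lim, of 2] by simp
  qed (use e_nonneg e_le in \<open>simp_all add: always_eventually\<close>)
  \<comment> \<open>The gradient of \<open>u n\<close> is \<open>G\<close> minus the error
    \<open>G - grad (u n)\<close>. Splitting the square with a free parameter \<open>t\<close> costs
    only the factor \<open>1 + t\<close> on the main term and puts all of the large factor
    \<open>1 + 1 / t\<close> on the error \<open>e n\<close>, which tends to 0.\<close>
  have B_le: "B \<le> (1 + t) * E + (1 + 1 / t) * e n" if t: "t > 0" for t n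
  proof -
    obtain C where C: "compact C" "C \<subseteq> U" "\<And>x. x \<notin> C \<Longrightarrow> \<phi> n x = 0"
      by (rule test_functionsE[OF \<phi>[of n]]) blast
    \<comment> \<open>The support of \<open>\<phi> n\<close> lies in a compact set \<open>C\<close>
      disjoint from \<open>K\<close>. Removing \<open>C\<close> from \<open>V\<close> leaves a
      neighbourhood of \<open>K\<close> on which \<open>u n\<close> is still exactly 1.\<close>
    have V': "open (V - C)" "K \<subseteq> V - C" "\<And>x. x \<in> V - C \<Longrightarrow> u n x = 1"
      using V C by (auto simp: open_Diff compact_imp_closed U_def u_def)
    \<comment> \<open>Off \<open>U\<close> there are two cases: on \<open>K\<close> the function
      \<open>u n\<close> is locally constant, and off \<open>\<Omega>\<close> it is outside its
      support. Hence its full energy is its energy on \<open>U\<close>, the only set where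
      convergence is known.\<close>
    have "grad (u n) x = 0" if "x \<notin> U" for x
    proof (cases "x \<in> K")
      case True
      then show ?thesis using grad_const_open[OF V'(1)] V'(2,3) by blast
    next
      case False
      then have "x \<notin> \<Omega>" using that by (simp add: U_def)
      moreover obtain D where "D \<subseteq> \<Omega>" "\<And>x. x \<notin> D \<Longrightarrow> grad (u n) x = 0"
        by (rule grad_test_function_outside[OF u_test[of n]]) blast
      ultimately show ?thesis by blast
    qed
    then have "(LINT x|lebesgue. (norm (grad (u n) x))\<^sup>2) = (LINT x|lebesgue_on U. (norm (grad (u n) x))\<^sup>2)"
      by (intro lebesgue_on_zero_outside[symmetric] U) auto
    also have "\<dots> \<le> (LINT x|lebesgue_on U. (1 + t) * (norm (G x))\<^sup>2 + (1 + 1 / t) * (norm (G x - grad (u n) x))\<^sup>2)"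
    proof (rule integral_mono)
      show "(norm (grad (u n) x))\<^sup>2 \<le> (1 + t) * (norm (G x))\<^sup>2 + (1 + 1 / t) * (norm (G x - grad (u n) x))\<^sup>2" for x
        using power2_norm_diff_le[OF t, of "G x" "G x - grad (u n) x"] by simp
    qed (use G_sq_U d_sq test_function_square_integrable(2)[OF u_test U(3)] in \<open>auto simp: square_integrable_def\<close>)
    also have "\<dots> = (1 + t) * E + (1 + 1 / t) * e n"
      unfolding E_def e_def using G_sq_U d_sq by (simp add: square_integrable_def)
    finally show ?thesis
      using B[OF u_test V'] by simp
  qed
  \<comment> \<open>The order of limits matters: first \<open>n\<close> tends to infinity with
    \<open>t\<close> fixed, and only then \<open>t\<close> tends to 0.\<close>
  have "B \<le> (1 + t) * E" if "t > 0" for t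
  proof (rule tendsto_lowerbound)
    show "(\<lambda>n. (1 + t) * E + (1 + 1 / t) * e n) \<longlonglongrightarrow> (1 + t) * E"
      using tendsto_add[OF tendsto_const tendsto_mult[OF tendsto_const e_lim], of "(1 + t) * E" "1 + 1 / t"] by simp
  qed (use B_le[OF that] in auto)
  then have "\<forall>\<^sub>F t in at_right 0. B \<le> (1 + t) * E"
    by (auto simp: eventually_at_right_less intro!: eventually_at_rightI[of 0 1])
  moreover have "((\<lambda>t. (1 + t) * E) \<longlongrightarrow> (1 + 0) * E) (at_right 0)"
    by (intro tendsto_intros)
  ultimately have "B \<le> E"
    using tendsto_lowerbound[of _ "(1 + 0) * E" "at_right (0::real)" B] by simp
  then show ?thesis
    using E_le by (simp add: E_def G_def)
qed

lemma cutoff_is_cutoff: "is_cutoff \<Omega> K \<eta> \<Longrightarrow> is_cutoff \<Omega> K (cutoff \<Omega> K)"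
  unfolding cutoff_def by (rule someI[of "is_cutoff \<Omega> K"])

text \<open>Both functions are 1 on a common neighbourhood of \<open>K\<close>, so their difference
  is supported in a compact subset of \<open>\<Omega> - K\<close>. Hence every cutoff is a
  competitor, whichever one the definition of the capacity has fixed.\<close>

lemma cutoff_admissible:
  assumes "open \<Omega>" "compact K" "is_cutoff \<Omega> K u" "is_cutoff \<Omega> K \<eta>"
  shows "u \<in> H10 \<Omega>" "(\<lambda>x. u x - \<eta> x) \<in> H10 (\<Omega> - K)"
proof -
  obtain V where V: "u \<in> test_functions \<Omega>" "open V" "K \<subseteq> V" "\<And>x. x \<in> V \<Longrightarrow> u x = 1"
    using assms(3) by (auto simp: is_cutoff_def)
  obtain W where W: "\<eta> \<in> test_functions \<Omega>" "open W" "K \<subseteq> W" "\<And>x. x \<in> W \<Longrightarrow> \<eta> x = 1"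
    using assms(4) by (auto simp: is_cutoff_def)
  show "u \<in> H10 \<Omega>" using V(1) assms(1) by (simp add: test_function_H10)
  obtain C where C: "compact C" "C \<subseteq> \<Omega>" "\<And>x. x \<notin> C \<Longrightarrow> u x = 0"
    by (rule test_functionsE[OF V(1)]) blast
  obtain D where D: "compact D" "D \<subseteq> \<Omega>" "\<And>x. x \<notin> D \<Longrightarrow> \<eta> x = 0"
    by (rule test_functionsE[OF W(1)]) blast
  have "(\<lambda>x. u x - \<eta> x) \<in> test_functions (\<Omega> - K)"
  proof (rule test_functionsI)
    show "smooth (\<lambda>x. u x - \<eta> x)"
      using V(1) W(1) by (intro smooth_diff test_functionsD(1))
    show "compact ((C \<union> D) - (V \<inter> W))"
      using C D V W by (intro compact_diff compact_Un open_Int)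
    show "C \<union> D - V \<inter> W \<subseteq> \<Omega> - K"
      using C(2) D(2) V(3) W(3) by blast
    show "u x - \<eta> x = 0" if "x \<notin> C \<union> D - V \<inter> W" for x
      using that C(3)[of x] D(3)[of x] V(4)[of x] W(4)[of x] by auto
  qed
  then show "(\<lambda>x. u x - \<eta> x) \<in> H10 (\<Omega> - K)"
    using assms(1,2) by (intro test_function_H10) (auto simp: open_Diff compact_imp_closed)
qed

lemma capacity_le_dirichlet:
  assumes "open \<Omega>" "compact K" "is_cutoff \<Omega> K u"
  shows "capacity \<Omega> K \<le> (LINT x|lebesgue. (norm (grad u x))\<^sup>2)"
proof -
  have "u \<in> test_functions \<Omega>"
    using assms(3) by (simp add: is_cutoff_def)
  from test_function_dirichlet[OF assms(1) this] show ?thesis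
    unfolding capacity_def
    using cutoff_admissible[OF assms cutoff_is_cutoff[OF assms(3)]]
    by (intro cInf_lower2[OF _ eq_refl] bdd_belowI[of _ 0])
      (force intro!: exI[of _ u], auto intro!: Bochner_Integration.integral_nonneg)
qed

text \<open>The existence of some cutoff \<open>u\<close> serves twice: it makes the chosen
  \<open>cutoff\<close> a genuine one, and it shows that the infimum is over a nonempty set.\<close>

lemma capacity_ge:
  assumes "open \<Omega>" "compact K" "is_cutoff \<Omega> K u"
    and "\<And>u V. u \<in> test_functions \<Omega> \<Longrightarrow> open V \<Longrightarrow> K \<subseteq> V \<Longrightarrow> (\<And>x. x \<in> V \<Longrightarrow> u x = 1) \<Longrightarrow>
        B \<le> (LINT x|lebesgue. (norm (grad u x))\<^sup>2)"
  shows "B \<le> capacity \<Omega> K"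
  unfolding capacity_def
proof (rule cInf_greatest)
  note adm = cutoff_admissible[OF assms(1-3) cutoff_is_cutoff[OF assms(3)]]
  show "{LINT x|lebesgue_on \<Omega>. (norm (weak_gradient \<Omega> f x))\<^sup>2 |f.
      f \<in> H10 \<Omega> \<and> (\<lambda>x. f x - cutoff \<Omega> K x) \<in> H10 (\<Omega> - K)} \<noteq> {}"
    using adm by blast
qed (use dirichlet_ge_of_test_functions[OF assms(1,2) cutoff_is_cutoff[OF assms(3)]] assms(4) in blast)

section \<open>Polar coordinates\<close>

lemma vec2_eq_iff: "(x :: 'a^2) = y \<longleftrightarrow> x $ 1 = y $ 1 \<and> x $ 2 = y $ 2"
  by (simp add: vec_eq_iff forall_2)

lemma continuous_on_vector2:
  assumes "continuous_on S f" "continuous_on S g"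
  shows "continuous_on S (\<lambda>x. vector [f x, g x] :: real^2)"
proof -
  have *: "(\<lambda>x. vector [f x, g x] :: real^2) = (\<lambda>x. \<chi> i::2. if i = 1 then f x else g x)"
    by (auto simp: vec2_eq_iff fun_eq_iff)
  show ?thesis
    unfolding *
  proof (rule continuous_on_vec_lambda)
    show "continuous_on S (\<lambda>x. if i = 1 then f x else g x)" for i :: 2
      by (cases "i = 1") (use assms in simp_all)
  qed
qed

lemma has_derivative_vector2:
  assumes "(f has_derivative f') (at x within S)" "(g has_derivative g') (at x within S)"
  shows "((\<lambda>x. vector [f x, g x] :: real^2) has_derivative (\<lambda>h. vector [f' h, g' h])) (at x within S)"
  unfolding has_derivative_componentwise_within[where f = "\<lambda>x. vector [f x, g x]"]
  using assms by (auto simp: Basis_vec_def inner_axis forall_2 eta_contract_eq)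

lemma cbox_vector2:
  "(\<lambda>p. vector [fst p, snd p] :: real^2) ` cbox u v = cbox (vector [fst u, snd u]) (vector [fst v, snd v])"
  "(\<lambda>z :: real^2. (z $ 1, z $ 2)) ` cbox a b = cbox (a $ 1, a $ 2) (b $ 1, b $ 2)"
proof -
  show "(\<lambda>p. vector [fst p, snd p] :: real^2) ` cbox u v = cbox (vector [fst u, snd u]) (vector [fst v, snd v])"
  proof (intro equalityI subsetI)
    fix z :: "real^2" assume "z \<in> cbox (vector [fst u, snd u]) (vector [fst v, snd v])"
    then show "z \<in> (\<lambda>p. vector [fst p, snd p]) ` cbox u v"
      by (intro image_eqI[of _ _ "(z $ 1, z $ 2)"]; cases u; cases v) (auto simp: vec2_eq_iff mem_box_cart forall_2)
  qed (cases u; cases v; auto simp: mem_box_cart forall_2)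
  show "(\<lambda>z :: real^2. (z $ 1, z $ 2)) ` cbox a b = cbox (a $ 1, a $ 2) (b $ 1, b $ 2)"
  proof (intro equalityI subsetI)
    fix p assume "p \<in> cbox (a $ 1, a $ 2) (b $ 1, b $ 2)"
    then show "p \<in> (\<lambda>z :: real^2. (z $ 1, z $ 2)) ` cbox a b"
      by (intro image_eqI[of _ _ "vector [fst p, snd p]"]; cases p) (auto simp: mem_box_cart forall_2)
  qed (auto simp: mem_box_cart forall_2)
qed

text \<open>Fubini's theorem is used for pairs; the volume-preserving bijection between pairs and
  vectors transports it to \<open>real^2\<close>.\<close>

lemma integral_cbox_vec2:
  fixes F :: "real^2 \<Rightarrow> real"
  assumes "continuous_on UNIV F"
  shows "integral (cbox a b) F =
    integral {a $ 1..b $ 1} (\<lambda>s. integral {a $ 2..b $ 2} (\<lambda>t. F (vector [s, t])))"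
proof -
  let ?g = "\<lambda>p. vector [fst p, snd p] :: real^2" and ?h = "\<lambda>z :: real^2. (z $ 1, z $ 2)"
  have cg: "continuous_on UNIV ?g"
    by (intro continuous_on_vector2 continuous_intros)
  have "((\<lambda>x. F (?g x)) has_integral (1 / 1) *\<^sub>R integral (cbox a b) F) (?h ` cbox a b)"
  proof (rule has_integral_twiddle)
    show "continuous (at x) ?g" for x
      using cg unfolding continuous_on_eq_continuous_at[OF open_UNIV] by blast
    show "measure lborel (?g ` cbox u v) = 1 * measure lborel (cbox u v)" for u v
    proof (cases u; cases v)
      fix u1 u2 v1 v2 assume uv: "u = (u1, u2)" "v = (v1, v2)"
      have "measure lborel (cbox (vector [u1, u2] :: real^2) (vector [v1, v2])) = measure lborel (cbox u1 v1) * measure lborel (cbox u2 v2)"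
        using cbox_vector2(1)[of "(u1, u2)" "(v1, v2)"]
        by (auto simp: content_cbox_if_cart UNIV_2 cbox_Pair_eq)
      then show ?thesis
        unfolding cbox_vector2 uv by (simp add: content_Pair)
    qed
    show "(F has_integral integral (cbox a b) F) (cbox a b)"
      by (intro integrable_integral integrable_continuous continuous_on_subset[OF assms]) simp
  qed (auto simp: vec2_eq_iff cbox_vector2)
  then have "integral (cbox a b) F = integral (cbox (a $ 1, a $ 2) (b $ 1, b $ 2)) (\<lambda>x. F (?g x))"
    by (simp add: cbox_vector2 integral_unique)
  also have "\<dots> = integral (cbox (a $ 1) (b $ 1)) (\<lambda>s. integral (cbox (a $ 2) (b $ 2)) (\<lambda>t. F (?g (s, t))))"
    by (intro integral_prod_continuous continuous_on_compose2[OF assms] continuous_on_subset[OF cg]) auto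
  finally show ?thesis by simp
qed

definition dir :: "real \<Rightarrow> real^2" where
  "dir t = vector [cos t, sin t]"

lemma dir_nth [simp]: "dir t $ 1 = cos t" "dir t $ 2 = sin t"
  by (simp_all add: dir_def)

lemma norm_vec2: "(norm (x :: real^2))\<^sup>2 = (x $ 1)\<^sup>2 + (x $ 2)\<^sup>2"
  by (simp add: norm_vec_def L2_set_def sum_2)

lemma norm_dir [simp]: "norm (dir t) = 1"
proof -
  have "(norm (dir t))\<^sup>2 = 1\<^sup>2" by (simp add: norm_vec2)
  then show ?thesis by (metis norm_ge_zero power2_eq_imp_eq zero_le_one)
qed

lemma continuous_on_dir: "continuous_on S dir"
  unfolding dir_def by (intro continuous_on_vector2 continuous_intros)

text \<open>\<open>dir (t + pi / 2)\<close> is the unit tangent to the circle at angle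
  \<open>t\<close>; writing it as a value of \<open>dir\<close> makes its norm 1 automatic.\<close>

lemma dir_has_derivative: "(dir has_derivative (\<lambda>h. h *\<^sub>R dir (t + pi / 2))) (at t)"
proof -
  have "((\<lambda>t. vector [cos t, sin t] :: real^2) has_derivative (\<lambda>h. vector [- sin t * h, cos t * h])) (at t)"
    by (intro has_derivative_vector2) (auto intro!: derivative_eq_intros simp: mult.commute)
  moreover have "(\<lambda>h. vector [- sin t * h, cos t * h] :: real^2) = (\<lambda>h. h *\<^sub>R dir (t + pi / 2))"
    by (auto simp: vec2_eq_iff fun_eq_iff sin_add cos_add)
  moreover have "dir = (\<lambda>t. vector [cos t, sin t])"
    by (simp add: dir_def fun_eq_iff)
  ultimately show ?thesis by simp
qed

lemma vec2_polar: "\<exists>t. 0 \<le> t \<and> t < 2 * pi \<and> x = norm x *\<^sub>R dir t"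
proof (cases "x = 0")
  case True
  then show ?thesis by (auto intro!: exI[of _ 0])
next
  case False
  then have "(x $ 1 / norm x)\<^sup>2 + (x $ 2 / norm x)\<^sup>2 = 1"
    by (simp add: power_divide add_divide_distrib[symmetric] norm_vec2[symmetric])
  then obtain t where "0 \<le> t" "t < 2 * pi" "x $ 1 / norm x = cos t" "x $ 2 / norm x = sin t"
    by (rule sincos_total_2pi)
  moreover from this have "x $ 1 = norm x * cos t" "x $ 2 = norm x * sin t"
    using False by (simp_all add: divide_eq_eq mult.commute)
  then have "x = norm x *\<^sub>R dir t"
    by (simp add: vec2_eq_iff)
  ultimately show ?thesis by blast
qed

lemma dir_inj:
  assumes "dir s = dir t" "0 \<le> s" "s < 2 * pi" "0 \<le> t" "t < 2 * pi"
  shows "s = t"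
proof -
  have "sin s = sin t \<and> cos s = cos t"
    using assms(1) by (simp add: vec2_eq_iff)
  then obtain n :: int where n: "s = t + 2 * pi * n"
    unfolding sin_cos_eq_iff by blast
  have "2 * pi * real_of_int n < 2 * pi * 1" "2 * pi * (- 1) < 2 * pi * real_of_int n"
    using n assms by linarith+
  from this[THEN mult_left_less_imp_less] have "real_of_int n < 1" "- 1 < real_of_int n"
    using pi_ge_zero by linarith+
  then have "n = 0" by linarith
  then show ?thesis using n by simp
qed

text \<open>On the open box of radii in \<open>(0, R)\<close> and angles in
  \<open>(0, 2 * pi)\<close> the polar map is injective with Jacobian determinant \<open>r\<close>.
  What its image misses of the open disc lies on a line, which is null.\<close>

lemma polar_integral:
  fixes Q :: "real^2 \<Rightarrow> real"
  assumes Q: "continuous_on UNIV Q" and supp: "\<And>x. norm x \<ge> R \<Longrightarrow> Q x = 0"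
  shows "(LINT x|lebesgue. Q x) = integral {0..R} (\<lambda>r. integral {0..2 * pi} (\<lambda>t. r * Q (r *\<^sub>R dir t)))"
proof -
  define g where "g = (\<lambda>z :: real^2. z $ 1 *\<^sub>R dir (z $ 2))"
  define g' where "g' = (\<lambda>(z :: real^2) (h :: real^2). h $ 1 *\<^sub>R dir (z $ 2) + (z $ 1 * h $ 2) *\<^sub>R dir (z $ 2 + pi / 2))"
  define a :: "real^2" where "a = 0"
  define b :: "real^2" where "b = vector [R, 2 * pi]"
  have ab: "a $ 1 = 0" "a $ 2 = 0" "b $ 1 = R" "b $ 2 = 2 * pi"
    by (simp_all add: a_def b_def)
  define S where "S = box a b"
  have S: "z \<in> S \<longleftrightarrow> 0 < z $ 1 \<and> z $ 1 < R \<and> 0 < z $ 2 \<and> z $ 2 < 2 * pi" for z :: "real^2"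
    by (auto simp: S_def mem_box_cart forall_2 ab)
  have der_g: "(g has_derivative g' z) (at z within S)" for z :: "real^2"
  proof -
    have lin: "((\<lambda>z :: real^2. z $ i) has_derivative (\<lambda>h. h $ i)) (at z within S)" for i
      by (rule bounded_linear.has_derivative[OF bounded_linear_vec_nth has_derivative_ident])
    show ?thesis
      unfolding g_def g'_def
      by (rule has_derivative_eq_rhs[OF has_derivative_scaleR[OF lin has_derivative_compose[OF lin dir_has_derivative]]])
        (simp add: fun_eq_iff)
  qed
  have det: "det (matrix (g' z)) = z $ 1" for z :: "real^2"
  proof -
    have "det (matrix (g' z)) = z $ 1 * (cos (z $ 2) * cos (z $ 2)) + z $ 1 * (sin (z $ 2) * sin (z $ 2))"
      by (simp add: det_2 matrix_def g'_def axis_def sin_add cos_add)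
    also have "\<dots> = z $ 1 * ((cos (z $ 2))\<^sup>2 + (sin (z $ 2))\<^sup>2)"
      by (simp only: power2_eq_square distrib_left)
    finally show ?thesis by simp
  qed
  have norm_g: "norm (g z) = z $ 1" if "z \<in> S" for z
    using that by (simp add: g_def S)
  have inj: "inj_on g S"
  proof (rule inj_onI)
    fix z w assume zw: "z \<in> S" "w \<in> S" "g z = g w"
    then have "z $ 1 = w $ 1" using norm_g by metis
    moreover from this have "dir (z $ 2) = dir (w $ 2)" using zw by (simp add: g_def S)
    then have "z $ 2 = w $ 2"
      using zw by (intro dir_inj) (auto simp: S)
    ultimately show "z = w" by (simp add: vec2_eq_iff)
  qed
  \<comment> \<open>The change of variables theorem is applied to vector-valued functions, so
    \<open>Q\<close> is wrapped into \<open>real^1\<close> and unwrapped by taking the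
    component.\<close>
  define f :: "real^2 \<Rightarrow> real^1" where "f = (\<lambda>x. vec (Q x))"
  define F where "F = (\<lambda>z. \<bar>z $ 1\<bar> * Q (g z))"
  have g_cont: "continuous_on UNIV g"
    unfolding g_def by (intro continuous_intros continuous_on_compose2[OF continuous_on_dir]) auto
  have F_cont: "continuous_on UNIV F"
    unfolding F_def by (intro continuous_intros continuous_on_compose2[OF Q] g_cont) auto
  have vecF: "(\<lambda>z. \<bar>det (matrix (g' z))\<bar> *\<^sub>R f (g z)) = (\<lambda>z. vec (F z))"
    by (simp add: det f_def F_def fun_eq_iff vec_eq_iff)
  have "(\<lambda>z. vec (F z) :: real^1) absolutely_integrable_on cbox a b"
    using F_cont unfolding vec_def
    by (intro absolutely_integrable_continuous continuous_on_vec_lambda) (auto intro: continuous_on_subset)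
  then have "(\<lambda>z. vec (F z) :: real^1) absolutely_integrable_on S"
    by (rule set_integrable_subset) (auto simp: S_def box_subset_cbox)
  then have "f absolutely_integrable_on g ` S \<and> integral (g ` S) f = integral S (\<lambda>z. vec (F z))"
    using has_absolute_integral_change_of_variables[of S g g' f "integral S (\<lambda>z. vec (F z))", OF _ der_g inj]
    unfolding vecF by (auto simp: S_def)
  then have 1: "integral (g ` S) f $ 1 = integral S (\<lambda>z. vec (F z) :: real^1) $ 1" and f_int: "f integrable_on g ` S"
    by (auto simp: absolutely_integrable_on_def)
  have vF_int: "(\<lambda>z. vec (F z) :: real^1) integrable_on S"
    using \<open>(\<lambda>z. vec (F z) :: real^1) absolutely_integrable_on S\<close> by (simp add: absolutely_integrable_on_def)
  have "integral (g ` S) Q = integral S F"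
    using 1 integral_component_eq_cart[OF f_int, of 1] integral_component_eq_cart[OF vF_int, of 1]
    by (simp add: f_def)
  also have "\<dots> = integral {0..R} (\<lambda>r. integral {0..2 * pi} (\<lambda>t. F (vector [r, t])))"
    unfolding S_def integral_open_interval integral_cbox_vec2[OF F_cont] ab ..
  also have "\<dots> = integral {0..R} (\<lambda>r. integral {0..2 * pi} (\<lambda>t. r * Q (r *\<^sub>R dir t)))"
    by (intro Henstock_Kurzweil_Integration.integral_cong) (simp add: F_def g_def)
  also have "integral (g ` S) Q = integral UNIV Q"
  proof (rule integral_spike_set)
    have "x $ 2 = 0" if "x \<notin> g ` S" "Q x \<noteq> 0" for x
    proof (rule ccontr)
      assume x2: "x $ 2 \<noteq> 0"
      obtain t where t: "0 \<le> t" "t < 2 * pi" "x = norm x *\<^sub>R dir t"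
        using vec2_polar by blast
      have "x $ 2 = norm x * sin t"
        using arg_cong[OF t(3), of "\<lambda>v. v $ 2"] by simp
      then have "t \<noteq> 0" using x2 by auto
      moreover have "0 < norm x" using x2 by auto
      moreover have "norm x < R" using supp[of x] that(2) by force
      ultimately have "vector [norm x, t] \<in> S"
        using t(1,2) by (simp add: S)
      moreover have "x = g (vector [norm x, t])"
        unfolding g_def by (simp add: t(3)[symmetric])
      ultimately show False using that(1) by blast
    qed
    then have "{x \<in> UNIV - g ` S. Q x \<noteq> 0} \<subseteq> {x. x $ 2 = 0}" by auto
    then show "negligible {x \<in> UNIV - g ` S. Q x \<noteq> 0}"
      by (rule negligible_subset[OF negligible_standard_hyperplane_cart])
  qed simp
  also have "integral UNIV Q = (LINT x|lebesgue. Q x)"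
  proof -
    have "integrable lborel Q"
      by (rule continuous_compact_support_integrable(1)[OF Q compact_cball[of 0 R]]) (use supp in auto)
    then show ?thesis
      by (simp add: integral_lborel integral_completion)
  qed
  finally show ?thesis .
qed

lemma polar_integral_at:
  fixes Q :: "real^2 \<Rightarrow> real"
  assumes Q: "continuous_on UNIV Q" and supp: "\<And>x. dist p x \<ge> R \<Longrightarrow> Q x = 0"
  shows "(LINT x|lebesgue. Q x) = integral {0..R} (\<lambda>r. integral {0..2 * pi} (\<lambda>t. r * Q (p + r *\<^sub>R dir t)))"
proof -
  have Q': "continuous_on UNIV (\<lambda>x. Q (p + x))"
    by (intro continuous_intros continuous_on_compose2[OF Q]) auto
  have meas: "Q \<in> borel_measurable borel" "(\<lambda>x. Q (p + x)) \<in> borel_measurable borel"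
    using Q Q' by (auto intro: borel_measurable_continuous_onI)
  have "(LINT x|lebesgue. Q x) = integral\<^sup>L (distr lborel borel ((+) p)) Q"
    using meas by (simp add: integral_completion lborel_distr_plus)
  also have "\<dots> = (LINT x|lebesgue. Q (p + x))"
    using meas by (simp add: integral_distr integral_completion)
  also have "\<dots> = integral {0..R} (\<lambda>r. integral {0..2 * pi} (\<lambda>t. r * Q (p + r *\<^sub>R dir t)))"
    by (rule polar_integral[OF Q']) (use supp in \<open>simp add: dist_norm\<close>)
  finally show ?thesis .
qed

section \<open>The upper bound\<close>

text \<open>The usual quotient built from \<open>exp (- 1 / t)\<close>: it is 0 for
  \<open>t \<le> 0\<close> and 1 for \<open>t \<ge> 1\<close>.\<close>

definition smooth_step :: "real \<Rightarrow> real" where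
  "smooth_step t = flat_step 0 t * inverse (flat_step 0 t + flat_step 0 (1 - t))"

lemma smooth_step_denominator: "0 < flat_step 0 t + flat_step 0 (1 - t)"
proof -
  have "0 < flat_step 0 s" if "s > 0" for s
    using that by (simp add: flat_step_def)
  then have "0 < flat_step 0 t \<or> 0 < flat_step 0 (1 - t)"
    by (cases "t > 0") auto
  then show ?thesis
    using flat_step_0_bounds(1)[of t] flat_step_0_bounds(1)[of "1 - t"] by linarith
qed

lemma smooth_smooth_step: "smooth smooth_step"
proof -
  have 1: "smooth (\<lambda>t. flat_step 0 (1 - t))"
    by (rule smooth_compose[OF smooth_flat_step smooth_diff[OF smooth_const smooth_ident]])
  have "smooth (\<lambda>t. flat_step 0 t * inverse (flat_step 0 t + flat_step 0 (1 - t)))"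
    using smooth_step_denominator
    by (intro smooth_mult smooth_inverse smooth_add smooth_flat_step 1) (metis less_irrefl)
  then show ?thesis
    by (simp add: smooth_step_def[abs_def])
qed

lemma smooth_step_bounds: "0 \<le> smooth_step t" "smooth_step t \<le> 1"
  using smooth_step_denominator[of t] flat_step_0_bounds(1)[of t] flat_step_0_bounds(1)[of "1 - t"]
  by (simp_all add: smooth_step_def divide_inverse[symmetric])

lemma smooth_step_eq_0: "t \<le> 0 \<Longrightarrow> smooth_step t = 0"
  and smooth_step_eq_1: "t \<ge> 1 \<Longrightarrow> smooth_step t = 1"
  using smooth_step_denominator[of t] by (simp_all add: smooth_step_def flat_step_def)

text \<open>The fundamental theorem needs \<open>s\<close> inside an interval starting at 0. Because
  \<open>w\<close> vanishes up to a positive \<open>a\<close>, the integral is locally 0 for every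
  \<open>s < a\<close>; this covers the endpoint 0 and negative \<open>s\<close>, where the interval
  is empty.\<close>

lemma integral_from_0_has_derivative:
  fixes w :: "real \<Rightarrow> real"
  assumes w: "continuous_on UNIV w" and a: "a > 0" "\<And>s. s \<le> a \<Longrightarrow> w s = 0"
  shows "((\<lambda>s. integral {0..s} w) has_real_derivative w s) (at s)"
proof (cases "s < a")
  case True
  have "integral {0..r} w = 0" if "r < a" for r
    using that a by (intro integral_unique has_integral_is_0) auto
  then have "((\<lambda>s. integral {0..s} w) has_derivative (\<lambda>_. 0)) (at s)"
    by (intro has_derivative_transform_within_open[OF has_derivative_const[of 0] open_lessThan[of a]])
      (use True in auto)
  then show ?thesis
    by (rule has_derivative_imp_has_field_derivative) (use True a in simp)
next
  case False
  then have s: "s \<in> {0<..<s + 1}" using a by auto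
  have "((\<lambda>s. integral {0..s} w) has_real_derivative w s) (at s within {0..s + 1})"
    using s by (intro integral_has_real_derivative continuous_on_subset[OF w]) auto
  then have "((\<lambda>s. integral {0..s} w) has_real_derivative w s) (at s within {0<..<s + 1})"
    by (rule has_field_derivative_subset) auto
  then show ?thesis
    using s at_within_open[of s "{0<..<s + 1}"] by auto
qed

text \<open>The weight \<open>w\<close> is a mollification of \<open>1 / s\<close> cut off to \<open>[2 d\<^sup>2, R\<^sup>2 / 2]\<close>: the logarithmic
  potential \<open>ln r\<close> is the function \<open>ln s / 2\<close> of the squared radius \<open>s = r\<^sup>2\<close>.\<close>

lemma radial_profile:
  fixes d R :: real
  assumes d: "d > 0" and R: "4 * d \<le> R" and pos: "2 * (ln R - ln d) - ln 272 / 2 > 0"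
  obtains W w :: "real \<Rightarrow> real" and I :: real
  where "\<And>s. (W has_real_derivative w s) (at s)" "smooth w" "smooth W"
    "\<And>s. s \<le> 2 * d\<^sup>2 \<Longrightarrow> W s = 0" "\<And>s. s \<ge> R\<^sup>2 / 2 \<Longrightarrow> W s = I"
    "\<And>s. s \<ge> 0 \<Longrightarrow> 0 \<le> w s" "\<And>s. s * w s \<le> 1" "I \<ge> 2 * (ln R - ln d) - ln 272 / 2"
proof -
  \<comment> \<open>The first factor climbs from 0 to 1 as \<open>s\<close> goes from
    \<open>2 * d^2\<close> to \<open>4 * d^2\<close>; the second falls from 1 to 0 as
    \<open>s\<close> goes from \<open>R^2 / 4\<close> to \<open>R^2 / 2\<close>.\<close>
  define \<psi> where "\<psi> = (\<lambda>s. smooth_step (s * (1 / (2 * d\<^sup>2)) - 1) * smooth_step (2 - s * (4 / R\<^sup>2)))"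
  \<comment> \<open>The quotient \<open>s / (s^2 + d^4)\<close> stands in for \<open>1 / s\<close>:
    it is smooth on the whole line, still satisfies \<open>s * w s \<le> 1\<close>, and has the
    explicit antiderivative \<open>ln (s^2 + d^4) / 2\<close>.\<close>
  define w where "w = (\<lambda>s. \<psi> s * (s * inverse (s * s + d ^ 4)))"
  define W where "W = (\<lambda>s. integral {0..s} w)"
  have den: "s * s + d ^ 4 > 0" for s
    using d by (intro add_nonneg_pos) auto
  have R0: "R > 0" using d R by linarith
  have \<psi>_smooth: "smooth \<psi>"
    unfolding \<psi>_def
    by (intro smooth_mult smooth_compose[OF smooth_smooth_step] smooth_diff smooth_const smooth_ident)
  have w_smooth: "smooth w"
    unfolding w_def using den by (intro smooth_mult \<psi>_smooth smooth_inverse smooth_add smooth_const smooth_ident)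
      (metis less_irrefl)
  have w_cont: "continuous_on S w" for S
    by (rule smooth_continuous[OF w_smooth])
  have \<psi>_bounds: "0 \<le> \<psi> s" "\<psi> s \<le> 1" for s
    unfolding \<psi>_def by (auto intro!: mult_nonneg_nonneg mult_le_one smooth_step_bounds)
  have \<psi>_low: "\<psi> s = 0" if "s \<le> 2 * d\<^sup>2" for s
    using that d by (simp add: \<psi>_def smooth_step_eq_0 field_simps)
  have \<psi>_high: "\<psi> s = 0" if "s \<ge> R\<^sup>2 / 2" for s
  proof -
    have "smooth_step (2 - s * (4 / R\<^sup>2)) = 0"
      using that R0 by (intro smooth_step_eq_0) (simp add: field_simps)
    then show ?thesis by (simp add: \<psi>_def)
  qed
  have \<psi>_mid: "\<psi> s = 1" if "4 * d\<^sup>2 \<le> s" "s \<le> R\<^sup>2 / 4" for s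
  proof -
    have "smooth_step (2 - s * (4 / R\<^sup>2)) = 1" "smooth_step (s * (1 / (2 * d\<^sup>2)) - 1) = 1"
      using that R0 d by (auto intro!: smooth_step_eq_1 simp: field_simps)
    then show ?thesis by (simp add: \<psi>_def)
  qed
  have deriv: "(W has_real_derivative w s) (at s)" for s
    unfolding W_def
    by (rule integral_from_0_has_derivative[OF w_cont, of "2 * d\<^sup>2"]) (use d in \<open>auto simp: w_def \<psi>_low\<close>)
  have w_nonneg: "0 \<le> w s" if "s \<ge> 0" for s
    unfolding w_def using that den[of s] \<psi>_bounds by (auto intro!: mult_nonneg_nonneg)
  have sw: "s * w s \<le> 1" for s
  proof -
    have "s * w s = \<psi> s * (s * s / (s * s + d ^ 4))"
      by (simp add: w_def divide_inverse)
    also have "\<dots> \<le> 1"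
      using den[of s] d by (intro mult_le_one \<psi>_bounds) auto
    finally show ?thesis .
  qed
  have W_low: "W s = 0" if "s \<le> 2 * d\<^sup>2" for s
    unfolding W_def using that by (intro integral_unique has_integral_is_0) (auto simp: w_def \<psi>_low)
  define I where "I = W (R\<^sup>2 / 2)"
  have W_high: "W s = I" if "s \<ge> R\<^sup>2 / 2" for s
  proof -
    have "(w has_integral (W s - W (R\<^sup>2 / 2))) {R\<^sup>2 / 2..s}"
      using that deriv by (intro fundamental_theorem_of_calculus)
        (auto simp flip: has_real_derivative_iff_has_vector_derivative intro: has_field_derivative_at_within)
    moreover have "(w has_integral 0) {R\<^sup>2 / 2..s}"
      by (rule has_integral_is_0) (simp add: w_def \<psi>_high)
    ultimately have "W s - W (R\<^sup>2 / 2) = 0"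
      by (rule has_integral_unique)
    then show ?thesis by (simp add: I_def)
  qed
  define v where "v = (\<lambda>s. s * inverse (s * s + d ^ 4))"
  have Rd: "4 * d\<^sup>2 \<le> R\<^sup>2 / 4"
  proof -
    have "(4 * d)\<^sup>2 \<le> R\<^sup>2" using R d by (intro power_mono) auto
    then show ?thesis by (simp add: power_mult_distrib)
  qed
  have "(v has_integral (ln ((R\<^sup>2 / 4) * (R\<^sup>2 / 4) + d ^ 4) / 2 - ln ((4 * d\<^sup>2) * (4 * d\<^sup>2) + d ^ 4) / 2)) {4 * d\<^sup>2..R\<^sup>2 / 4}"
  proof (rule fundamental_theorem_of_calculus[OF Rd])
    fix s assume "s \<in> {4 * d\<^sup>2..R\<^sup>2 / 4}"
    have "((\<lambda>s. ln (s * s + d ^ 4) / 2) has_real_derivative v s) (at s)"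
      using den[of s] by (auto intro!: derivative_eq_intros simp: v_def field_simps)
    then show "((\<lambda>s. ln (s * s + d ^ 4) / 2) has_vector_derivative v s) (at s within {4 * d\<^sup>2..R\<^sup>2 / 4})"
      by (simp flip: has_real_derivative_iff_has_vector_derivative add: has_field_derivative_at_within)
  qed
  then have v_int: "v integrable_on {4 * d\<^sup>2..R\<^sup>2 / 4}"
    and v_eq: "integral {4 * d\<^sup>2..R\<^sup>2 / 4} v = ln ((R\<^sup>2 / 4) * (R\<^sup>2 / 4) + d ^ 4) / 2 - ln ((4 * d\<^sup>2) * (4 * d\<^sup>2) + d ^ 4) / 2"
    by (auto simp: integral_unique)
  have "integral {4 * d\<^sup>2..R\<^sup>2 / 4} v = integral {4 * d\<^sup>2..R\<^sup>2 / 4} w"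
    by (intro Henstock_Kurzweil_Integration.integral_cong) (simp add: v_def w_def \<psi>_mid)
  also have "\<dots> \<le> integral {0..R\<^sup>2 / 2} w"
  proof (rule integral_subset_le)
    have "R\<^sup>2 / 4 \<le> R\<^sup>2 / 2" "0 \<le> 4 * d\<^sup>2" by simp_all
    then show "{4 * d\<^sup>2..R\<^sup>2 / 4} \<subseteq> {0..R\<^sup>2 / 2}" by (simp only: atLeastatMost_subset_iff) blast
  qed (auto intro!: integrable_continuous_real w_cont w_nonneg)
  finally have "integral {4 * d\<^sup>2..R\<^sup>2 / 4} v \<le> I"
    by (simp add: I_def W_def)
  \<comment> \<open>Origin of \<open>272 = 16 * 17\<close>: at the upper end the argument of the
    logarithm is at least \<open>R^4 / 16\<close>, and at the lower end it equals
    \<open>16 * d^4 + d^4\<close>.\<close>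
  moreover have "2 * (ln R - ln d) - ln 272 / 2 \<le> integral {4 * d\<^sup>2..R\<^sup>2 / 4} v"
  proof -
    have "ln (R ^ 4 / 16) \<le> ln ((R\<^sup>2 / 4) * (R\<^sup>2 / 4) + d ^ 4)"
      using R0 d by (intro ln_mono add_pos_pos) (auto simp: power2_eq_square power4_eq_xxxx)
    moreover have "ln (R ^ 4 / 16) = 4 * ln R - ln 16"
      using R0 by (simp add: ln_div ln_realpow)
    moreover have "ln ((4 * d\<^sup>2) * (4 * d\<^sup>2) + d ^ 4) = ln (17 * d ^ 4)"
      by (rule arg_cong[of _ _ ln]) (simp add: power2_eq_square power4_eq_xxxx)
    moreover have "ln (17 * d ^ 4) = ln 17 + 4 * ln d"
      using d by (simp add: ln_mult ln_realpow)
    moreover have "ln 272 = ln 16 + ln (17 :: real)"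
      using ln_mult[of 16 "17 :: real"] by simp
    moreover have "2 * (x - t) - (y + z) / 2 \<le> a / 2 - b / 2" if "4 * x - y \<le> a" "b = z + 4 * t" for a b x y z t :: real
      using that by (simp add: field_simps)
    ultimately show ?thesis
      unfolding v_eq by metis
  qed
  ultimately have I: "I \<ge> 2 * (ln R - ln d) - ln 272 / 2" by linarith
  show ?thesis
    by (rule that[OF deriv w_smooth smooth_antiderivative[OF deriv w_smooth] W_low W_high w_nonneg sw I])
qed

lemma smooth_norm_squared: "smooth (\<lambda>x. (norm (x - p))\<^sup>2)"
proof -
  have "(\<lambda>x. (norm (x - p))\<^sup>2) = (\<lambda>x. \<Sum>i\<in>Basis. (x \<bullet> i - p \<bullet> i) * (x \<bullet> i - p \<bullet> i))"
  proof
    fix x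
    show "(norm (x - p))\<^sup>2 = (\<Sum>i\<in>Basis. (x \<bullet> i - p \<bullet> i) * (x \<bullet> i - p \<bullet> i))"
      unfolding power2_norm_eq_inner by (subst euclidean_inner) (simp add: inner_diff_left)
  qed
  moreover have "smooth \<dots>"
    by (intro smooth_sum smooth_mult smooth_diff smooth_inner smooth_const)
  ultimately show ?thesis by simp
qed

lemma grad_radial:
  assumes "\<And>s. (W has_real_derivative w s) (at s)"
  shows "grad (\<lambda>x. c - b * W ((norm (x - p))\<^sup>2)) x = (- 2 * b * w ((norm (x - p))\<^sup>2)) *\<^sub>R (x - p)"
proof (rule grad_eqI)
  have "((\<lambda>x. (norm (x - p))\<^sup>2) has_derivative (\<lambda>h. 2 * ((x - p) \<bullet> h))) (at x)"
    unfolding power2_norm_eq_inner by (auto intro!: derivative_eq_intros simp: inner_commute)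
  from has_derivative_compose[OF this assms[unfolded has_field_derivative_def]]
  have "((\<lambda>x. W ((norm (x - p))\<^sup>2)) has_derivative (\<lambda>h. w ((norm (x - p))\<^sup>2) * (2 * ((x - p) \<bullet> h)))) (at x)" .
  then show "((\<lambda>x. c - b * W ((norm (x - p))\<^sup>2)) has_derivative
      (\<lambda>h. ((- 2 * b * w ((norm (x - p))\<^sup>2)) *\<^sub>R (x - p)) \<bullet> h)) (at x)"
    by (auto intro!: derivative_eq_intros simp: fun_eq_iff)
qed

text \<open>For \<open>u = 1 - W (r^2) / I\<close> the squared gradient is
  \<open>4 * r^2 * (w (r^2))^2 / I^2\<close>. Bounding one factor \<open>r^2 * w (r^2)\<close> by 1
  leaves, after the Jacobian, a multiple of the derivative of \<open>W (r^2)\<close>. The energy is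
  thus at most \<open>4 * pi / I^2\<close> times the total increment \<open>I\<close>.\<close>

lemma radial_cutoff:
  fixes p :: "real^2"
  assumes d: "d > 0" and R: "4 * d \<le> R" and pos: "2 * (ln R - ln d) - ln 272 / 2 > 0"
    and \<Omega>: "cball p R \<subseteq> \<Omega>" and K: "K \<subseteq> cball p d"
  obtains u where "is_cutoff \<Omega> K u"
    "(LINT x|lebesgue. (norm (grad u x))\<^sup>2) \<le> 4 * pi / (2 * (ln R - ln d) - ln 272 / 2)"
proof -
  obtain W w I where W: "\<And>s. (W has_real_derivative w s) (at s)" "smooth w" "smooth W"
    "\<And>s. s \<le> 2 * d\<^sup>2 \<Longrightarrow> W s = 0" "\<And>s. s \<ge> R\<^sup>2 / 2 \<Longrightarrow> W s = I"
    "\<And>s. s \<ge> 0 \<Longrightarrow> 0 \<le> w s" "\<And>s. s * w s \<le> 1" "I \<ge> 2 * (ln R - ln d) - ln 272 / 2"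
    by (rule radial_profile[OF d R pos]) blast
  have I: "I > 0" using W(8) pos by linarith
  have R0: "R > 0" using d R by linarith
  define u where "u = (\<lambda>x. 1 - (1 / I) * W ((norm (x - p))\<^sup>2))"
  have u_smooth: "smooth u"
    unfolding u_def by (intro smooth_diff smooth_const smooth_mult smooth_compose[OF W(3)] smooth_norm_squared)
  have u_test: "u \<in> test_functions \<Omega>"
  proof (rule test_functionsI[OF u_smooth compact_cball \<Omega>])
    fix x assume "x \<notin> cball p R"
    then have "R\<^sup>2 \<le> (norm (x - p))\<^sup>2"
      using R0 by (intro power_mono) (auto simp: dist_norm norm_minus_commute)
    then have "R\<^sup>2 / 2 \<le> (norm (x - p))\<^sup>2"
      using zero_le_power2[of R] by linarith
    then show "u x = 0" using I by (simp add: u_def W)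
  qed
  \<comment> \<open>\<open>W\<close> is flat up to \<open>2 * d^2\<close> rather than
    \<open>d^2\<close> so that \<open>u\<close> is 1 on an open disc strictly larger than
    \<open>cball p d\<close>, as a cutoff requires.\<close>
  have u1: "u x = 1" if "norm (x - p) < sqrt 2 * d" for x
  proof -
    have "(norm (x - p))\<^sup>2 \<le> (sqrt 2 * d)\<^sup>2"
      using that by (intro power_mono) auto
    then show ?thesis
      by (simp add: u_def W power_mult_distrib)
  qed
  have "open (ball p (sqrt 2 * d))" "K \<subseteq> ball p (sqrt 2 * d)"
    using K d by (auto simp: subset_iff intro: le_less_trans)
  then have cut: "is_cutoff \<Omega> K u"
    using u_test u1 by (auto simp: is_cutoff_def dist_norm norm_minus_commute intro!: exI[of _ "ball p (sqrt 2 * d)"])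
  define q where "q = (\<lambda>r. 4 * r\<^sup>2 * ((1 / I) * w (r\<^sup>2))\<^sup>2)"
  have grad_u: "(norm (grad u x))\<^sup>2 = q (norm (x - p))" for x
    unfolding u_def grad_radial[OF W(1)] q_def
    by (simp add: power_mult_distrib power_divide)
  have w_cont: "continuous_on S w" for S by (rule smooth_continuous[OF W(2)])
  have q_cont: "continuous_on S (\<lambda>x. q (f x))" if "continuous_on S f" for S :: "'b::topological_space set" and f
    unfolding q_def by (intro continuous_intros continuous_on_compose2[OF w_cont[of UNIV]] that) auto
  \<comment> \<open>The profile only records that \<open>W\<close> is constant beyond
    \<open>R^2 / 2\<close>; uniqueness of derivatives gives the vanishing of \<open>w\<close>
    there.\<close>
  have w_out: "w s = 0" if "s > R\<^sup>2 / 2" for s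
  proof -
    have "((\<lambda>s. I) has_derivative (\<lambda>x. w s * x)) (at s)"
      using that by (intro has_derivative_transform_within_open[OF W(1)[unfolded has_field_derivative_def, of s] open_greaterThan[of "R\<^sup>2 / 2"]])
        (auto simp: W(5))
    then have "(\<lambda>x. w s * x) = (\<lambda>_. 0)"
      using has_derivative_unique has_derivative_const by blast
    then show ?thesis by (metis mult.right_neutral)
  qed
  have "(LINT x|lebesgue. (norm (grad u x))\<^sup>2) = (LINT x|lebesgue. q (norm (x - p)))"
    by (simp add: grad_u)
  also have "\<dots> = integral {0..R} (\<lambda>r. integral {0..2 * pi} (\<lambda>t. r * q (norm (p + r *\<^sub>R dir t - p))))"
  proof (rule polar_integral_at)
    show "continuous_on UNIV (\<lambda>x. q (norm (x - p)))"
      by (intro q_cont continuous_intros)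
    fix x assume "R \<le> dist p x"
    then have "R\<^sup>2 \<le> (norm (x - p))\<^sup>2"
      using R0 by (intro power_mono) (auto simp: dist_norm norm_minus_commute)
    moreover have "R\<^sup>2 > 0" using R0 by simp
    ultimately have "R\<^sup>2 / 2 < (norm (x - p))\<^sup>2" by linarith
    then show "q (norm (x - p)) = 0" by (simp add: q_def w_out)
  qed
  also have "\<dots> = integral {0..R} (\<lambda>r. 2 * pi * (r * q r))"
    by (intro Henstock_Kurzweil_Integration.integral_cong) simp
  also have "\<dots> \<le> integral {0..R} (\<lambda>r. (8 * pi / I\<^sup>2) * (r * w (r\<^sup>2)))"
  proof (rule integral_le)
    fix r assume "r \<in> {0..R}"
    then have r: "0 \<le> r" by simp
    have "(r\<^sup>2 * w (r\<^sup>2)) * (r * w (r\<^sup>2)) \<le> 1 * (r * w (r\<^sup>2))"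
      using r by (intro mult_right_mono W mult_nonneg_nonneg) auto
    then have "(8 * pi / I\<^sup>2) * ((r\<^sup>2 * w (r\<^sup>2)) * (r * w (r\<^sup>2))) \<le> (8 * pi / I\<^sup>2) * (r * w (r\<^sup>2))"
      by (intro mult_left_mono) auto
    moreover have "2 * pi * (r * q r) = (8 * pi / I\<^sup>2) * ((r\<^sup>2 * w (r\<^sup>2)) * (r * w (r\<^sup>2)))"
      by (simp add: q_def power2_eq_square)
    ultimately show "2 * pi * (r * q r) \<le> (8 * pi / I\<^sup>2) * (r * w (r\<^sup>2))" by simp
  qed (use I in \<open>auto intro!: integrable_continuous_real continuous_intros q_cont continuous_on_compose2[OF w_cont[of UNIV]]\<close>)
  also have "\<dots> = 4 * pi / I"
  proof -
    have "((\<lambda>r. (8 * pi / I\<^sup>2) * (r * w (r\<^sup>2))) has_integral ((4 * pi / I\<^sup>2) * W (R\<^sup>2) - (4 * pi / I\<^sup>2) * W (0\<^sup>2))) {0..R}"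
    proof (rule fundamental_theorem_of_calculus)
      fix r
      have "((\<lambda>r. (4 * pi / I\<^sup>2) * W (r\<^sup>2)) has_real_derivative (8 * pi / I\<^sup>2) * (r * w (r\<^sup>2))) (at r within {0..R})"
      proof -
        have "((\<lambda>r. (4 * pi / I\<^sup>2) * W (r\<^sup>2)) has_real_derivative (4 * pi / I\<^sup>2) * (w (r\<^sup>2) * (2 * r))) (at r within {0..R})"
          by (rule DERIV_cmult[OF DERIV_chain2[OF W(1)]]) (auto intro!: derivative_eq_intros)
        then show ?thesis by (simp add: mult_ac)
      qed
      then show "((\<lambda>r. (4 * pi / I\<^sup>2) * W (r\<^sup>2)) has_vector_derivative (8 * pi / I\<^sup>2) * (r * w (r\<^sup>2))) (at r within {0..R})"
        by (simp add: has_real_derivative_iff_has_vector_derivative)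
    qed (use R0 in simp)
    from integral_unique[OF this] show ?thesis
      unfolding W(4)[of "0\<^sup>2", simplified] W(5)[of "R\<^sup>2", simplified]
      using I W(4)[of 0] by (simp add: power2_eq_square)
  qed
  also have "\<dots> \<le> 4 * pi / (2 * (ln R - ln d) - ln 272 / 2)"
    using W(8) pos by (intro divide_left_mono mult_pos_pos I) auto
  finally show ?thesis
    using that cut by blast
qed

section \<open>The lower bound\<close>

lemma abs_increment_le_integral:
  fixes \<phi> :: "real \<Rightarrow> real"
  assumes deriv: "\<And>s. (\<phi> has_real_derivative \<phi>' s) (at s)"
    and le: "\<And>s. s \<in> {l..h} \<Longrightarrow> \<bar>\<phi>' s\<bar> \<le> g s" and g: "continuous_on {l..h} g"
    and ab: "a \<in> {l..h}" "b \<in> {l..h}"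
  shows "\<bar>\<phi> b - \<phi> a\<bar> \<le> integral {l..h} g"
proof -
  have *: "\<bar>\<phi> b - \<phi> a\<bar> \<le> integral {l..h} g" if "a \<le> b" "a \<in> {l..h}" "b \<in> {l..h}" for a b
  proof -
    have sub: "{a..b} \<subseteq> {l..h}" using that by auto
    have "(\<phi>' has_integral (\<phi> b - \<phi> a)) {a..b}"
      using that(1) deriv by (intro fundamental_theorem_of_calculus)
        (auto simp flip: has_real_derivative_iff_has_vector_derivative intro: has_field_derivative_at_within)
    moreover have int: "g integrable_on {a..b}" "g integrable_on {l..h}"
      using continuous_on_subset[OF g sub] g by (auto intro: integrable_continuous_real)
    ultimately have "norm (\<phi> b - \<phi> a) \<le> integral {a..b} g"
      using le sub by (metis (no_types, lifting) has_integral_iff integral_norm_bound_integral real_norm_def subsetD)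
    also have "\<dots> \<le> integral {l..h} g"
      using le by (intro integral_subset_le sub int) (meson abs_ge_zero order_trans)
    finally show ?thesis by simp
  qed
  show ?thesis
    using *[of a b] *[of b a] ab by (cases "a \<le> b") (auto simp: abs_minus_commute)
qed

text \<open>The distances from \<open>p\<close> to points of \<open>K\<close> form a connected set
  of reals containing 0 and \<open>dist p q\<close>, hence every value in between.\<close>

lemma connected_meets_circles:
  fixes p :: "real^2"
  assumes K: "connected K" "p \<in> K" "q \<in> K" and r: "0 \<le> r" "r \<le> dist p q"
  shows "\<exists>t\<in>{0..2 * pi}. p + r *\<^sub>R dir t \<in> K"
proof -
  have "connected (dist p ` K)"
    by (intro connected_continuous_image continuous_intros K(1))
  moreover have "dist p p \<in> dist p ` K" "dist p q \<in> dist p ` K"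
    using K by blast+
  ultimately have "{dist p p..dist p q} \<subseteq> dist p ` K"
    by (rule connected_contains_Icc)
  then obtain x where x: "x \<in> K" "dist p x = r" using r by force
  obtain t where t: "0 \<le> t" "t < 2 * pi" "x - p = norm (x - p) *\<^sub>R dir t"
    using vec2_polar by blast
  have "p + r *\<^sub>R dir t = x"
    using t(3) x(2) by (simp add: dist_norm norm_minus_commute algebra_simps)
  then show ?thesis using t(1,2) x(1) by (intro bexI[of _ t]) auto
qed

text \<open>A pointwise substitute for Cauchy-Schwarz. The factor \<open>r\<close> is placed on
  \<open>G^2\<close> so that integration reproduces the energy in polar coordinates.\<close>

lemma weighted_am_gm:
  fixes G k r a :: real
  assumes "a > 0" "r > 0"
  shows "G * k \<le> (a * (r * G\<^sup>2) + k\<^sup>2 / (a * r)) / 2"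
proof -
  have "0 \<le> (a * r * G - k)\<^sup>2 / (a * r)"
    using assms by simp
  also have "\<dots> = a * (r * G\<^sup>2) + k\<^sup>2 / (a * r) - 2 * (G * k)"
    using assms by (simp add: power2_diff power_mult_distrib field_simps power2_eq_square)
  finally show ?thesis by simp
qed

text \<open>Averaging the angular increment on a circle of radius \<open>r \<in> [d / 2, d]\<close> and the radial increment
  from \<open>r\<close> to \<open>M\<close> over all angles and all such \<open>r\<close> bounds a weighted \<open>L\<^sup>1\<close> norm of the gradient
  from below by 1.  The weight has squared \<open>L\<^sup>2\<close> norm \<open>ln (M / d) / (2 * pi) + O(1)\<close>, so a single
  use of Cauchy-Schwarz does not lose the constant.\<close>

lemma dirichlet_lower_bound:
  fixes u :: "real^2 \<Rightarrow> real"
  assumes u: "u \<in> test_functions \<Omega>" and \<Omega>: "\<Omega> \<subseteq> ball p M" and d: "0 < d" "d < M"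
    and circ: "\<And>r. 0 \<le> r \<Longrightarrow> r \<le> d \<Longrightarrow> \<exists>t\<in>{0..2 * pi}. u (p + r *\<^sub>R dir t) = 1"
  shows "1 / (18 * pi + ln (M / d) / (2 * pi)) \<le> (LINT x|lebesgue. (norm (grad u x))\<^sup>2)"
proof -
  note sm = test_functionsD(1)[OF u]
  define G where "G = (\<lambda>r t. norm (grad u (p + r *\<^sub>R dir t)))"
  \<comment> \<open>\<open>c r\<close> is the angular integral of the gradient norm without
    Jacobian; \<open>e r\<close> is the energy per unit radius with Jacobian, so that
    \<open>e\<close> integrates to \<open>E\<close>.\<close>
  define c where "c = (\<lambda>r. integral {0..2 * pi} (\<lambda>t. G r t))"
  define e where "e = (\<lambda>r. integral {0..2 * pi} (\<lambda>t. r * (G r t)\<^sup>2))"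
  define E where "E = (LINT x|lebesgue. (norm (grad u x))\<^sup>2)"
  have G_cont: "continuous_on S (\<lambda>x. G (f x) (h x))"
    if "continuous_on S f" "continuous_on S h" for S :: "'b::topological_space set" and f h
    unfolding G_def
    by (intro continuous_intros continuous_on_compose2[OF continuous_grad[OF sm, of UNIV]]
        continuous_on_compose2[OF continuous_on_dir[of UNIV]] that) auto
  have G_nonneg: "0 \<le> G r t" for r t
    by (simp add: G_def)
  have c_cont: "continuous_on S c" for S
    unfolding c_def cbox_interval[symmetric]
    by (rule integral_continuous_on_param) (auto simp: case_prod_beta intro!: G_cont continuous_intros)
  have e_cont: "continuous_on S e" for S
    unfolding e_def cbox_interval[symmetric]
    by (rule integral_continuous_on_param) (auto simp: case_prod_beta intro!: G_cont continuous_intros)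
  have outside: "u x = 0" "grad u x = 0" if "dist p x \<ge> M" for x
  proof -
    obtain C where "C \<subseteq> \<Omega>" "\<And>x. x \<notin> C \<Longrightarrow> u x = 0" "\<And>x. x \<notin> C \<Longrightarrow> grad u x = 0"
      by (rule grad_test_function_outside[OF u]) blast
    moreover have "x \<notin> \<Omega>" using that \<Omega> by auto
    ultimately show "u x = 0" "grad u x = 0" by blast+
  qed
  have E_eq: "E = integral {0..M} e"
    unfolding E_def e_def G_def
    by (rule polar_integral_at[of "\<lambda>x. (norm (grad u x))\<^sup>2"])
      (auto intro!: continuous_intros continuous_grad sm simp: outside)
  have angular: "\<bar>u (p + r *\<^sub>R dir s) - u (p + r *\<^sub>R dir t)\<bar> \<le> r * c r"
    if "r \<ge> 0" "s \<in> {0..2 * pi}" "t \<in> {0..2 * pi}" for r s t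
  proof -
    have "\<bar>u (p + r *\<^sub>R dir s) - u (p + r *\<^sub>R dir t)\<bar> \<le> integral {0..2 * pi} (\<lambda>t. r * G r t)"
    proof (rule abs_increment_le_integral[OF _ _ _ that(3,2)])
      fix t
      have "((\<lambda>t. p + r *\<^sub>R dir t) has_derivative (\<lambda>h. r *\<^sub>R (h *\<^sub>R dir (t + pi / 2)))) (at t)"
        by (auto intro!: derivative_eq_intros dir_has_derivative)
      from has_derivative_compose[OF this smooth_has_derivative_grad[OF sm]]
      show "((\<lambda>t. u (p + r *\<^sub>R dir t)) has_real_derivative grad u (p + r *\<^sub>R dir t) \<bullet> (r *\<^sub>R dir (t + pi / 2))) (at t)"
        by (rule has_derivative_imp_has_field_derivative) simp
      show "\<bar>grad u (p + r *\<^sub>R dir t) \<bullet> (r *\<^sub>R dir (t + pi / 2))\<bar> \<le> r * G r t"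
        using Cauchy_Schwarz_ineq2[of "grad u (p + r *\<^sub>R dir t)" "r *\<^sub>R dir (t + pi / 2)"] that(1)
        by (simp add: G_def mult.commute)
    qed (intro continuous_intros G_cont)
    then show ?thesis by (simp add: c_def)
  qed
  have radial: "\<bar>u (p + r *\<^sub>R dir t)\<bar> \<le> integral {d / 2..M} (\<lambda>r. G r t)" if "r \<in> {d / 2..M}" for r t
  proof -
    have "\<bar>u (p + r *\<^sub>R dir t) - u (p + M *\<^sub>R dir t)\<bar> \<le> integral {d / 2..M} (\<lambda>r. G r t)"
    proof (rule abs_increment_le_integral[OF _ _ _ _ that])
      fix r
      have "((\<lambda>r. p + r *\<^sub>R dir t) has_derivative (\<lambda>h. h *\<^sub>R dir t)) (at r)"
        by (auto intro!: derivative_eq_intros)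
      from has_derivative_compose[OF this smooth_has_derivative_grad[OF sm]]
      show "((\<lambda>r. u (p + r *\<^sub>R dir t)) has_real_derivative grad u (p + r *\<^sub>R dir t) \<bullet> dir t) (at r)"
        by (rule has_derivative_imp_has_field_derivative) simp
      show "\<bar>grad u (p + r *\<^sub>R dir t) \<bullet> dir t\<bar> \<le> G r t"
        using Cauchy_Schwarz_ineq2[of "grad u (p + r *\<^sub>R dir t)" "dir t"] by (simp add: G_def)
    qed (use d in \<open>auto intro!: G_cont continuous_intros\<close>)
    moreover have "u (p + M *\<^sub>R dir t) = 0"
      by (rule outside) (use d in \<open>simp add: dist_norm\<close>)
    ultimately show ?thesis by simp
  qed
  define b where "b = (\<lambda>t. integral {d / 2..M} (\<lambda>r. G r t))"
  have b_cont: "continuous_on S b" for S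
    unfolding b_def cbox_interval[symmetric]
    by (rule integral_continuous_on_param) (auto simp: case_prod_beta intro!: G_cont continuous_intros)
  \<comment> \<open>The path runs along the circle from a point where \<open>u = 1\<close> to angle
    \<open>t\<close>, then out along the ray to distance \<open>M\<close>, where
    \<open>u = 0\<close>. The bound \<open>b t\<close> starts at \<open>d / 2\<close> so that it
    serves all \<open>r\<close> in the annulus.\<close>
  have one_le: "1 \<le> r * c r + b t" if "r \<in> {d / 2..d}" "t \<in> {0..2 * pi}" for r t
  proof -
    have "0 \<le> r" "r \<le> d" using that d by auto
    then obtain s where s: "s \<in> {0..2 * pi}" "u (p + r *\<^sub>R dir s) = 1"
      using circ by blast
    then show ?thesis
      using angular[of r s t] radial[of r t] that d unfolding b_def by auto
  qed
  have b_swap: "integral {0..2 * pi} b = integral {d / 2..M} c"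
    unfolding b_def c_def
    using integral_swap_continuous[of 0 "d / 2" "2 * pi" M "\<lambda>t r. G r t"]
    by (simp add: case_prod_beta G_cont continuous_intros)
  have "2 * pi \<le> 2 * pi * (r * c r) + integral {d / 2..M} c" if "r \<in> {d / 2..d}" for r
  proof -
    have "integral {0..2 * pi} (\<lambda>_. 1) \<le> integral {0..2 * pi} (\<lambda>t. r * c r + b t)"
      by (intro integral_le integrable_continuous_real continuous_intros b_cont one_le that)
    also have "\<dots> = integral {0..2 * pi} (\<lambda>t. r * c r) + integral {0..2 * pi} b"
      by (intro Henstock_Kurzweil_Integration.integral_add integrable_continuous_real continuous_intros b_cont)
    finally show ?thesis unfolding b_swap by (simp add: mult_ac)
  qed
  \<comment> \<open>Averaging over \<open>r\<close> as well: the left side is \<open>pi * d\<close>,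
    and division by it normalises the total to 1.\<close>
  then have "integral {d / 2..d} (\<lambda>_. 2 * pi) \<le> integral {d / 2..d} (\<lambda>r. 2 * pi * (r * c r) + integral {d / 2..M} c)"
    by (intro integral_le integrable_continuous_real continuous_intros c_cont)
  also have "\<dots> = integral {d / 2..d} (\<lambda>r. 2 * pi * (r * c r)) + integral {d / 2..d} (\<lambda>_. integral {d / 2..M} c)"
    by (intro Henstock_Kurzweil_Integration.integral_add integrable_continuous_real continuous_intros c_cont)
  finally have "pi * d \<le> 2 * pi * integral {d / 2..d} (\<lambda>r. r * c r) + d / 2 * integral {d / 2..M} c"
    unfolding Henstock_Kurzweil_Integration.integral_mult_right using d by (simp add: mult_ac)
  then have "1 \<le> (2 / d) * integral {d / 2..d} (\<lambda>r. r * c r) + (1 / (2 * pi)) * integral {d / 2..M} c"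
    using d by (simp add: field_simps)
  also have "integral {d / 2..M} c = integral {d / 2..d} c + integral {d..M} c"
    using d by (intro Henstock_Kurzweil_Integration.integral_combine[symmetric] integrable_continuous_real c_cont) auto
  also have "(2 / d) * integral {d / 2..d} (\<lambda>r. r * c r) + (1 / (2 * pi)) * (integral {d / 2..d} c + integral {d..M} c)
      = integral {d / 2..d} (\<lambda>r. c r * (2 * r / d + 1 / (2 * pi))) + integral {d..M} (\<lambda>r. c r * (1 / (2 * pi)))"
  proof -
    have "integral {d / 2..d} (\<lambda>r. c r * (2 * r / d + 1 / (2 * pi))) =
        integral {d / 2..d} (\<lambda>r. (2 / d) * (r * c r) + (1 / (2 * pi)) * c r)"
      by (intro Henstock_Kurzweil_Integration.integral_cong) (simp add: algebra_simps)
    also have "\<dots> = integral {d / 2..d} (\<lambda>r. (2 / d) * (r * c r)) + integral {d / 2..d} (\<lambda>r. (1 / (2 * pi)) * c r)"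
      by (intro Henstock_Kurzweil_Integration.integral_add integrable_continuous_real continuous_intros c_cont)
    also have "\<dots> = (2 / d) * integral {d / 2..d} (\<lambda>r. r * c r) + (1 / (2 * pi)) * integral {d / 2..d} c"
      by (simp only: Henstock_Kurzweil_Integration.integral_mult_right)
    moreover have "integral {d..M} (\<lambda>r. c r * (1 / (2 * pi))) = (1 / (2 * pi)) * integral {d..M} c"
      by (simp only: Henstock_Kurzweil_Integration.integral_mult_left mult.commute)
    ultimately show ?thesis
      by (simp only: distrib_left add.assoc)
  qed
  finally have weighted: "1 \<le> integral {d / 2..d} (\<lambda>r. c r * (2 * r / d + 1 / (2 * pi)))
      + integral {d..M} (\<lambda>r. c r * (1 / (2 * pi)))" .
  \<comment> \<open>\<open>A\<close> bounds the double integral of \<open>k^2 / r\<close>, where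
    \<open>k\<close> is the weight. On \<open>[d / 2, d]\<close> one has \<open>k \<le> 3\<close>
    and \<open>1 / r \<le> 2 / d\<close>, contributing at most \<open>18 * pi\<close>; beyond
    \<open>d\<close> the weight is \<open>1 / (2 * pi)\<close>, contributing the logarithm. Using
    this same \<open>A\<close> as the parameter of the inequality between means gives
    \<open>1 \<le> A / 2 * E + 1 / 2\<close>, that is \<open>E \<ge> 1 / A\<close>.\<close>
  define A where "A = 18 * pi + ln (M / d) / (2 * pi)"
  have A: "A > 0"
    unfolding A_def using d by (intro add_pos_nonneg) auto
  have c_le: "c r * k \<le> (A * e r + 2 * pi * (k\<^sup>2 / (A * r))) / 2" if r: "r > 0" for r k
  proof -
    have "c r * k = integral {0..2 * pi} (\<lambda>t. G r t * k)"
      by (simp add: c_def)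
    also have "\<dots> \<le> integral {0..2 * pi} (\<lambda>t. (A / 2) * (r * (G r t)\<^sup>2) + k\<^sup>2 / (A * r) / 2)"
      using weighted_am_gm[OF A r] by (intro integral_le integrable_continuous_real continuous_intros G_cont)
        (simp add: add_divide_distrib)
    also have "\<dots> = integral {0..2 * pi} (\<lambda>t. (A / 2) * (r * (G r t)\<^sup>2)) + integral {0..2 * pi} (\<lambda>t. k\<^sup>2 / (A * r) / 2)"
      by (intro Henstock_Kurzweil_Integration.integral_add integrable_continuous_real continuous_intros G_cont)
    also have "\<dots> = (A * e r + 2 * pi * (k\<^sup>2 / (A * r))) / 2"
      by (simp add: e_def add_divide_distrib)
    finally show ?thesis .
  qed
  have inner: "integral {d / 2..d} (\<lambda>r. c r * (2 * r / d + 1 / (2 * pi))) \<le> A / 2 * integral {d / 2..d} e + 9 * pi / A"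
  proof -
    have "integral {d / 2..d} (\<lambda>r. c r * (2 * r / d + 1 / (2 * pi))) \<le> integral {d / 2..d} (\<lambda>r. A / 2 * e r + 18 * pi / (A * d))"
    proof (rule integral_le)
      fix r assume r: "r \<in> {d / 2..d}"
      have r0: "r > 0" using r d by auto
      define k where "k = 2 * r / d + 1 / (2 * pi)"
      have "2 * r / d \<le> 2" using r d by (simp add: field_simps)
      moreover have "1 / (2 * pi) \<le> 1" using pi_ge_two by (simp add: field_simps)
      ultimately have "k \<le> 3" unfolding k_def by linarith
      moreover have "0 \<le> k" using r0 d by (simp add: k_def)
      ultimately have "k\<^sup>2 \<le> 3\<^sup>2" by (intro power_mono)
      moreover have "A * d / 2 \<le> A * r" using r A by simp
      ultimately have "k\<^sup>2 / (A * r) \<le> 9 / (A * d / 2)"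
        using A d by (intro frac_le) auto
      then have "2 * pi * (k\<^sup>2 / (A * r)) \<le> 2 * pi * (9 / (A * d / 2))"
        by (intro mult_left_mono) auto
      with c_le[OF r0, of k] show "c r * (2 * r / d + 1 / (2 * pi)) \<le> A / 2 * e r + 18 * pi / (A * d)"
        unfolding k_def[symmetric] by simp
    qed (intro integrable_continuous_real continuous_intros c_cont e_cont; use d in simp)+
    also have "\<dots> = integral {d / 2..d} (\<lambda>r. A / 2 * e r) + integral {d / 2..d} (\<lambda>r. 18 * pi / (A * d))"
      by (intro Henstock_Kurzweil_Integration.integral_add integrable_continuous_real continuous_intros e_cont)
    also have "\<dots> = A / 2 * integral {d / 2..d} e + 9 * pi / A"
      using d A by (simp add: field_simps)
    finally show ?thesis .
  qed
  have outer: "integral {d..M} (\<lambda>r. c r * (1 / (2 * pi))) \<le> A / 2 * integral {d..M} e + ln (M / d) / (4 * pi * A)"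
  proof -
    have "integral {d..M} (\<lambda>r. c r * (1 / (2 * pi))) \<le> integral {d..M} (\<lambda>r. A / 2 * e r + 1 / (4 * pi * A) * (1 / r))"
    proof (rule integral_le)
      fix r assume r: "r \<in> {d..M}"
      then have "r > 0" using d by auto
      from c_le[OF this, of "1 / (2 * pi)"]
      show "c r * (1 / (2 * pi)) \<le> A / 2 * e r + 1 / (4 * pi * A) * (1 / r)"
        by (simp add: power2_eq_square add_divide_distrib mult_ac)
    qed (intro integrable_continuous_real continuous_intros c_cont e_cont; use d in auto)+
    also have "\<dots> = integral {d..M} (\<lambda>r. A / 2 * e r) + integral {d..M} (\<lambda>r. 1 / (4 * pi * A) * (1 / r))"
      using d by (intro Henstock_Kurzweil_Integration.integral_add integrable_continuous_real continuous_intros e_cont) auto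
    also have "integral {d..M} (\<lambda>r. 1 / (4 * pi * A) * (1 / r)) = 1 / (4 * pi * A) * (ln M - ln d)"
    proof -
      have "((\<lambda>r. 1 / r) has_integral (ln M - ln d)) {d..M}"
        using d by (intro fundamental_theorem_of_calculus)
          (auto simp flip: has_real_derivative_iff_has_vector_derivative intro!: derivative_eq_intros)
      then show ?thesis
        using integral_unique by (metis Henstock_Kurzweil_Integration.integral_mult_right)
    qed
    finally show ?thesis
      using d by (simp add: ln_div)
  qed
  have "integral {d / 2..d} e + integral {d..M} e = integral {d / 2..M} e"
    using d by (intro Henstock_Kurzweil_Integration.integral_combine integrable_continuous_real e_cont) auto
  also have "\<dots> \<le> E"
    unfolding E_eq
  proof (rule integral_subset_le)
    show "\<forall>r\<in>{0..M}. 0 \<le> e r"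
      unfolding e_def
      by (intro ballI Henstock_Kurzweil_Integration.integral_nonneg integrable_continuous_real continuous_intros G_cont) auto
  qed (use d in \<open>auto intro!: integrable_continuous_real e_cont\<close>)
  finally have "A / 2 * (integral {d / 2..d} e + integral {d..M} e) \<le> A / 2 * E"
    using A by (intro mult_left_mono) auto
  moreover have "9 * pi / A + ln (M / d) / (4 * pi * A) = 1 / 2"
  proof -
    have "9 * pi / A + ln (M / d) / (4 * pi * A) = (9 * pi + ln (M / d) / (4 * pi)) / A"
      by (simp add: add_divide_distrib)
    also have "9 * pi + ln (M / d) / (4 * pi) = A / 2"
      by (simp add: A_def)
    finally show ?thesis using A by simp
  qed
  ultimately have "1 \<le> A / 2 * E + 1 / 2"
    using weighted inner outer unfolding distrib_left by linarith
  then show ?thesis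
    using A unfolding A_def[symmetric] E_def[symmetric] by (simp add: field_simps)
qed

section \<open>From the two bounds to the asymptotic expansion\<close>

lemma capacity_bounds:
  fixes \<Omega> K :: "(real^2) set"
  assumes \<Omega>: "open \<Omega>" and K: "compact K" "connected K" and d: "d = diameter K" "d > 0"
    and R: "4 * d \<le> R" "2 * (ln R - ln d) - ln 272 / 2 > 0" "\<And>p. p \<in> K \<Longrightarrow> cball p R \<subseteq> \<Omega>"
    and M: "\<And>p. p \<in> K \<Longrightarrow> \<Omega> \<subseteq> ball p M" "d < M"
  shows "capacity \<Omega> K \<le> 4 * pi / (2 * (ln R - ln d) - ln 272 / 2)"
    and "1 / (18 * pi + ln (M / d) / (2 * pi)) \<le> capacity \<Omega> K"
proof -
  have "K \<noteq> {}" using d by auto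
  \<comment> \<open>A pair realising the diameter serves both bounds: \<open>K\<close> lies in the
    disc of radius \<open>d\<close> about \<open>p\<close>, and it meets all circles about
    \<open>p\<close> up to radius \<open>d\<close>.\<close>
  then obtain p q where pq: "p \<in> K" "q \<in> K" "dist p q = d"
    using diameter_compact_attained[OF K(1)] d(1) by metis
  have "K \<subseteq> cball p d"
    using diameter_bounded_bound[OF compact_imp_bounded[OF K(1)] pq(1)] d(1) by auto
  then obtain u where u: "is_cutoff \<Omega> K u"
    "(LINT x|lebesgue. (norm (grad u x))\<^sup>2) \<le> 4 * pi / (2 * (ln R - ln d) - ln 272 / 2)"
    using radial_cutoff[OF d(2) R(1,2) R(3)[OF pq(1)]] by metis
  show "capacity \<Omega> K \<le> 4 * pi / (2 * (ln R - ln d) - ln 272 / 2)"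
    using capacity_le_dirichlet[OF \<Omega> K(1) u(1)] u(2) by linarith
  show "1 / (18 * pi + ln (M / d) / (2 * pi)) \<le> capacity \<Omega> K"
  proof (rule capacity_ge[OF \<Omega> K(1) u(1)])
    fix v V assume v: "v \<in> test_functions \<Omega>" and V: "K \<subseteq> V" "\<And>x. x \<in> V \<Longrightarrow> v x = 1"
    show "1 / (18 * pi + ln (M / d) / (2 * pi)) \<le> (LINT x|lebesgue. (norm (grad v x))\<^sup>2)"
    proof (rule dirichlet_lower_bound[OF v M(1)[OF pq(1)] d(2) M(2)])
      fix r assume "0 \<le> r" "r \<le> d"
      then show "\<exists>t\<in>{0..2 * pi}. v (p + r *\<^sub>R dir t) = 1"
        using connected_meets_circles[OF K(2) pq(1,2), of r] pq(3) V by blast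
    qed
  qed
qed

text \<open>Since \<open>L + c \<ge> L / 2\<close>, a bounded shift of the reciprocal of the
  capacity changes the capacity only at order \<open>1 / L^2\<close>.\<close>

lemma inverse_shift_bound:
  fixes L c C :: real
  assumes "\<bar>c\<bar> \<le> C" "2 * C \<le> L" "L > 0"
  shows "\<bar>1 / (L + c) - 1 / L\<bar> \<le> 2 * C / L\<^sup>2"
proof -
  have Lc: "L / 2 \<le> L + c" "0 < L + c" using assms by linarith+
  have "1 / (L + c) - 1 / L = - c / ((L + c) * L)"
    using Lc assms by (simp add: field_simps)
  then have "\<bar>1 / (L + c) - 1 / L\<bar> = \<bar>c\<bar> / ((L + c) * L)"
    using Lc assms by (simp add: abs_mult)
  also have "\<dots> \<le> C / ((L / 2) * L)"
    using Lc assms by (intro frac_le mult_right_mono mult_pos_pos) auto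
  finally show ?thesis by (simp add: power2_eq_square mult.commute)
qed

theorem proposition1p6:
  fixes \<Omega> :: "(real ^ 2) set" and K :: "real \<Rightarrow> (real ^ 2) set" and x0 :: "real ^ 2"
    and \<delta> :: "real \<Rightarrow> real"
  assumes "open \<Omega>" and "bounded \<Omega>" and "connected \<Omega>" and "x0 \<in> \<Omega>"
    and "\<And>\<epsilon>. \<epsilon> > 0 \<Longrightarrow> compact (K \<epsilon>)"
    and "\<And>\<epsilon>. \<epsilon> > 0 \<Longrightarrow> connected (K \<epsilon>)"
    and "\<And>\<epsilon>. \<epsilon> > 0 \<Longrightarrow> K \<epsilon> \<subseteq> \<Omega>"
    and "concentrating \<Omega> K x0"
    and "\<And>\<epsilon>. \<epsilon> > 0 \<Longrightarrow> \<delta> \<epsilon> = diameter (K \<epsilon>)"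
    and "\<And>\<epsilon>. \<epsilon> > 0 \<Longrightarrow> \<delta> \<epsilon> > 0"
  shows "filterlim \<delta> (at_right 0) (at_right 0) \<and>
    (\<lambda>\<epsilon>. capacity \<Omega> (K \<epsilon>) - 2 * pi / \<bar>ln (\<delta> \<epsilon>)\<bar>)
      \<in> O[at_right 0](\<lambda>\<epsilon>. 1 / (ln (\<delta> \<epsilon>))\<^sup>2)"
proof -
  have pos: "\<forall>\<^sub>F \<epsilon> in at_right 0. (0::real) < \<epsilon>"
    by (simp add: eventually_at_right_less)
  have conc: "\<forall>\<^sub>F \<epsilon> in at_right 0. K \<epsilon> \<subseteq> ball x0 \<rho>" if "\<rho> > 0" for \<rho>
  proof -
    have "open (\<Omega> \<inter> ball x0 \<rho>)" "\<Omega> \<inter> ball x0 \<rho> \<subseteq> \<Omega>" "x0 \<in> \<Omega> \<inter> ball x0 \<rho>"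
      using assms(1,4) that by auto
    then obtain \<epsilon>0 where "\<epsilon>0 > 0" "\<And>\<epsilon>. 0 < \<epsilon> \<Longrightarrow> \<epsilon> < \<epsilon>0 \<Longrightarrow> K \<epsilon> \<subseteq> \<Omega> \<inter> ball x0 \<rho>"
      using assms(8) unfolding concentrating_def by meson
    then show ?thesis
      by (intro eventually_at_rightI[of 0 \<epsilon>0]) auto
  qed
  have small: "\<forall>\<^sub>F \<epsilon> in at_right 0. \<delta> \<epsilon> < s" if "s > 0" for s
  proof -
    \<comment> \<open>A disc of radius \<open>s / 3\<close> has diameter \<open>2 * s / 3\<close>,
      strictly below \<open>s\<close>.\<close>
    from that have "s / 3 > 0" by simp
    from conc[OF this] pos show ?thesis
    proof eventually_elim
      case (elim \<epsilon>)
      have "diameter (K \<epsilon>) \<le> diameter (ball x0 (s / 3))"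
        using elim(1) by (intro diameter_subset) auto
      then show ?case
        using assms(9)[OF elim(2)] that by simp
    qed
  qed
  have lim: "filterlim \<delta> (at_right 0) (at_right 0)"
    unfolding filterlim_at
  proof
    show "\<forall>\<^sub>F \<epsilon> in at_right 0. \<delta> \<epsilon> \<in> {0<..} \<and> \<delta> \<epsilon> \<noteq> 0"
      using pos by eventually_elim (use assms(10) in force)
    show "(\<delta> \<longlongrightarrow> 0) (at_right 0)"
    proof (rule tendstoI)
      fix s :: real assume "s > 0"
      from small[OF this] pos show "\<forall>\<^sub>F \<epsilon> in at_right 0. dist (\<delta> \<epsilon>) 0 < s"
        by eventually_elim (use assms(10) in \<open>force simp: dist_real_def\<close>)
    qed
  qed
  obtain \<rho> where \<rho>: "\<rho> > 0" "cball x0 \<rho> \<subseteq> \<Omega>"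
    using assms(1,4) open_contains_cball by blast
  \<comment> \<open>The centre \<open>p\<close> moves with \<open>\<epsilon>\<close>. Halving
    \<open>\<rho>\<close> makes one radius work for every \<open>p\<close> within \<open>R\<close>
    of \<open>x0\<close>.\<close>
  define R where "R = \<rho> / 2"
  have R: "R > 0" using \<rho> by (simp add: R_def)
  obtain B where B: "B > 0" "\<And>x. x \<in> \<Omega> \<Longrightarrow> norm x \<le> B"
    using assms(2) unfolding bounded_pos by blast
  \<comment> \<open>Two points of \<open>\<Omega>\<close> are at distance at most
    \<open>2 * B\<close>, so the open disc of radius \<open>M\<close> about any point of
    \<open>\<Omega>\<close> contains all of \<open>\<Omega>\<close>.\<close>
  define M where "M = 2 * B + 1"
  have M: "M > 0" using B by (simp add: M_def)
  \<comment> \<open>These are the shifts of \<open>L\<close> in the two bounds after the common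
    factor is taken out; the term \<open>36 * pi^2\<close> in \<open>c2\<close> is
    \<open>18 * pi\<close> times \<open>2 * pi\<close>.\<close>
  define c1 where "c1 = ln R - ln 272 / 4"
  define c2 where "c2 = ln M + 36 * pi\<^sup>2"
  define C where "C = max 1 (max \<bar>c1\<bar> \<bar>c2\<bar>)"
  have C: "\<bar>c1\<bar> \<le> C" "\<bar>c2\<bar> \<le> C" "1 \<le> C" by (auto simp: C_def)
  have "(\<lambda>\<epsilon>. capacity \<Omega> (K \<epsilon>) - 2 * pi / \<bar>ln (\<delta> \<epsilon>)\<bar>) \<in> O[at_right 0](\<lambda>\<epsilon>. 1 / (ln (\<delta> \<epsilon>))\<^sup>2)"
  proof (rule bigoI[where c = "4 * pi * C"])
    \<comment> \<open>A diameter below \<open>exp (- 2 * C)\<close> gives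
      \<open>L > 2 * C > 0\<close>. This keeps both denominators positive and identifies the
      absolute value of the logarithm with \<open>L\<close>.\<close>
    have "exp (- 2 * C) > 0" "R / 4 > 0" using R by auto
    from conc[OF R] small[OF this(1)] small[OF this(2)] small[OF M] pos
    show "\<forall>\<^sub>F \<epsilon> in at_right 0. norm (capacity \<Omega> (K \<epsilon>) - 2 * pi / \<bar>ln (\<delta> \<epsilon>)\<bar>)
        \<le> 4 * pi * C * norm (1 / (ln (\<delta> \<epsilon>))\<^sup>2)"
    proof eventually_elim
      case (elim \<epsilon>)
      define L where "L = - ln (\<delta> \<epsilon>)"
      note \<delta>0 = assms(10)[OF elim(5)]
      have "ln (\<delta> \<epsilon>) < - 2 * C"
        using elim(2) \<delta>0 by (metis exp_gt_zero ln_exp ln_less_cancel_iff)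
      then have L: "2 * C \<le> L" "L > 0" using C by (simp_all add: L_def)
      have K1: "cball p R \<subseteq> \<Omega>" if "p \<in> K \<epsilon>" for p
      proof -
        have "dist x0 p < R" using that elim(1) by auto
        then have "cball p R \<subseteq> cball x0 \<rho>"
          by (intro cball_subset_cball_iff[THEN iffD2]) (simp add: R_def dist_commute)
        then show ?thesis using \<rho>(2) by blast
      qed
      have K2: "\<Omega> \<subseteq> ball p M" if "p \<in> K \<epsilon>" for p
      proof
        fix x assume "x \<in> \<Omega>"
        moreover have "p \<in> \<Omega>" using that assms(7)[OF elim(5)] by blast
        ultimately have "norm (p - x) \<le> B + B"
          using B(2) norm_triangle_ineq4[of p x] by (meson add_mono order_trans)
        then show "x \<in> ball p M" by (simp add: dist_norm M_def)
      qed
      have denom: "2 * (ln R - ln (\<delta> \<epsilon>)) - ln 272 / 2 = 2 * (L + c1)"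
        by (simp add: L_def c1_def)
      have "L + c1 > 0" "L + c2 > 0" using C L by linarith+
      then have pos': "2 * (ln R - ln (\<delta> \<epsilon>)) - ln 272 / 2 > 0"
        unfolding denom by simp
      have "4 * \<delta> \<epsilon> \<le> R" using elim(3) by simp
      note cap = capacity_bounds[OF assms(1) assms(5,6,9,10)[OF elim(5)] this pos' K1 K2 elim(4)]
      have upper: "capacity \<Omega> (K \<epsilon>) \<le> 2 * pi * (1 / (L + c1))"
      proof -
        have "4 * pi / (2 * x) = 2 * pi * (1 / x)" for x by simp
        then show ?thesis using cap(1) unfolding denom by metis
      qed
      have "18 * pi + ln (M / \<delta> \<epsilon>) / (2 * pi) = (L + c2) / (2 * pi)"
        using M \<delta>0 by (simp add: ln_div L_def c2_def field_simps power2_eq_square)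
      then have lower: "2 * pi * (1 / (L + c2)) \<le> capacity \<Omega> (K \<epsilon>)"
        using cap(2) by simp
      have "1 / (L + c1) \<le> 1 / L + 2 * C / L\<^sup>2" "1 / L - 2 * C / L\<^sup>2 \<le> 1 / (L + c2)"
        using inverse_shift_bound[OF C(1) L] inverse_shift_bound[OF C(2) L] by linarith+
      from this[THEN mult_left_mono, of "2 * pi"]
      have "2 * pi * (1 / (L + c1)) \<le> 2 * pi * (1 / L + 2 * C / L\<^sup>2)"
        "2 * pi * (1 / L - 2 * C / L\<^sup>2) \<le> 2 * pi * (1 / (L + c2))"
        by simp_all
      with upper lower have "\<bar>capacity \<Omega> (K \<epsilon>) - 2 * pi / L\<bar> \<le> 4 * pi * C * (1 / L\<^sup>2)"
        by (simp add: abs_le_iff algebra_simps)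
      then show ?case
        using L(2) by (simp add: L_def)
    qed
  qed
  with lim show ?thesis by blast
qed

end
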